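(* Let $G$ be a finite group with trivial center $Z(G)=1$, let $S\subseteq G$ be a subgroup, $\alpha\in Z^2(S,k^* )$ a non-degenerate 2-cocycle, and $A=A(G,S,\alpha)$ the associated $k^G$-Galois object. Let $F$ be a normal subgroup of $G$ such that $[G:F]$ is prime. Then the subalgebra of invariants $A^F$ is a $k^G$-submodule of $A$ with respect to the Miyashita-Ulbrich action if and only if $S\subseteq F$.
   Context: $k$ is an algebraically closed field of characteristic zero. $k^G$ is the Hopf algebra of functions on $G$, with basis of idempotents $e_g$, $e_g(h)=\delta_{g,h}$. For a 2-cocycle $\alpha$ on $S$ (trivial action on $k^*$), $k_\alpha S$ is the twisted group algebra with basis $(x_s)_{s\in S}$, $x_sx_t=\alpha(s,t)x_{st}$; $\alpha$ is non-degenerate if $1$ is the only $s\in S$ with $\alpha(s,t)=\alpha(t,s)$ for all $t\in C_S(s)$. $A(G,S,\alpha)=\{f:G\to k_\alpha S : f(sg)=s\rhd f(g)\ \forall s\in S,g\in G\}$ with pointwise product, $s\rhd x_t=x_sx_tx_s^{-1}$, and $G$-action $(g.f)(h)=f(hg)$. It is a right $k^G$-Galois object via $\rho(a)=\sum_{g}g.a\otimes e_g$, i.e. $A^{\mathrm{co}\,k^G}=k$ and $A\otimes A\to A\otimes k^G$, $x\otimes y\mapsto xy_{(0)}\otimes y_{(1)}$, is bijective. $A^F$ is the subalgebra of elements fixed by $F$. The Miyashita-Ulbrich action of $H$ on an $H$-Galois object $A$ is the unique map $A\otimes H\to A$, $x\otimes h\mapsto x\leftharpoonup h$, such that $xy=y_{(0)}(x\leftharpoonup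 y_{(1)})$ for all $x,y\in A$. For $H=k^G$ it amounts to a $G$-grading $A=\bigoplus_{g\in G}A_g$ with $A_g=A\leftharpoonup e_g=\{a\in A: ax=(g.x)a\ \forall x\in A\}$. *)

theory Defs
  imports
    "HOL-Algebra.Coset"
    "HOL-Algebra.Module"
    "HOL-Computational_Algebra.Polynomial"
begin

section \<open>Groups and 2-cocycles\<close>

definition grp_centralizer :: "('g, 'm) monoid_scheme \<Rightarrow> 'g set \<Rightarrow> 'g \<Rightarrow> 'g set" where
  "grp_centralizer G S s = {t \<in> S. s \<otimes>\<^bsub>G\<^esub> t = t \<otimes>\<^bsub>G\<^esub> s}"

definition grp_center :: "('g, 'm) monoid_scheme \<Rightarrow> 'g set" where
  "grp_center G = {z \<in> carrier G. \<forall>g\<in>carrier G. z \<otimes>\<^bsub>G\<^esub> g = g \<otimes>\<^bsub>G\<^esub> z}"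

text \<open>Cocycles are not assumed to be normalised; only the values of \<open>\<alpha>\<close> on \<open>S \<times> S\<close> matter.\<close>

definition two_cocycle ::
  "('g, 'm) monoid_scheme \<Rightarrow> 'g set \<Rightarrow> ('g \<Rightarrow> 'g \<Rightarrow> 'k::field) \<Rightarrow> bool" where
  "two_cocycle G S \<alpha> \<longleftrightarrow>
     (\<forall>s\<in>S. \<forall>t\<in>S. \<alpha> s t \<noteq> 0) \<and>
     (\<forall>s\<in>S. \<forall>t\<in>S. \<forall>u\<in>S. \<alpha> s t * \<alpha> (s \<otimes>\<^bsub>G\<^esub> t) u = \<alpha> t u * \<alpha> s (t \<otimes>\<^bsub>G\<^esub> u))"

definition nondegenerate_cocycle ::
  "('g, 'm) monoid_scheme \<Rightarrow> 'g set \<Rightarrow> ('g \<Rightarrow> 'g \<Rightarrow> 'k::field) \<Rightarrow> bool" where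
  "nondegenerate_cocycle G S \<alpha> \<longleftrightarrow>
     {s \<in> S. \<forall>t\<in>grp_centralizer G S s. \<alpha> s t = \<alpha> t s} = {\<one>\<^bsub>G\<^esub>}"


section \<open>Function algebras and twisted group algebras\<close>

text \<open>
  A \<open>k\<close>-algebra, commutative or not, is given by a record of type \<open>module\<close>, whose scalars are
  the elements of the type \<open>'k\<close>. Functions on a set are extensional
  (\<open>undefined\<close> off the set), so that equality of functions is equality in HOL.
\<close>

definition scalar_algebra :: "('k::field, 'k) module" where
  "scalar_algebra =
     \<lparr>carrier = UNIV, monoid.mult = (*), one = 1, ring.zero = 0, add = (+), module.smult = (*)\<rparr>"

definition function_algebra :: "'x set \<Rightarrow> ('k, 'b) module \<Rightarrow> ('k, 'x \<Rightarrow> 'b) module" where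
  "function_algebra X B =
     \<lparr>carrier = X \<rightarrow>\<^sub>E carrier B,
      monoid.mult = (\<lambda>f g. \<lambda>x\<in>X. f x \<otimes>\<^bsub>B\<^esub> g x),
      one = (\<lambda>x\<in>X. \<one>\<^bsub>B\<^esub>),
      ring.zero = (\<lambda>x\<in>X. \<zero>\<^bsub>B\<^esub>),
      add = (\<lambda>f g. \<lambda>x\<in>X. f x \<oplus>\<^bsub>B\<^esub> g x),
      module.smult = (\<lambda>c f. \<lambda>x\<in>X. c \<odot>\<^bsub>B\<^esub> f x)\<rparr>"

text \<open>The algebra \<open>k\<^sup>G\<close>.\<close>

definition functions_on_group :: "('g, 'm) monoid_scheme \<Rightarrow> ('k::field, 'g \<Rightarrow> 'k) module" where
  "functions_on_group G = function_algebra (carrier G) scalar_algebra"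

definition point_idem :: "('g, 'm) monoid_scheme \<Rightarrow> 'g \<Rightarrow> 'g \<Rightarrow> 'k::field" where
  "point_idem G g = (\<lambda>h\<in>carrier G. if h = g then 1 else 0)"

text \<open>
  An element \<open>\<Sum>s\<in>S. a s x\<^sub>s\<close> of \<open>k\<^sub>\<alpha>S\<close> is encoded by its coefficient function \<open>a\<close>.
  Since \<open>\<alpha>\<close> need not be normalised, the unit is \<open>\<alpha>(1,1)\<^sup>-\<^sup>1 x\<^sub>1\<close>.
\<close>

definition twisted_group_algebra ::
  "('g, 'm) monoid_scheme \<Rightarrow> 'g set \<Rightarrow> ('g \<Rightarrow> 'g \<Rightarrow> 'k::field) \<Rightarrow> ('k, 'g \<Rightarrow> 'k) module" where
  "twisted_group_algebra G S \<alpha> =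
     \<lparr>carrier = S \<rightarrow>\<^sub>E UNIV,
      monoid.mult = (\<lambda>a b. \<lambda>u\<in>S.
        \<Sum>(s, t) | s \<in> S \<and> t \<in> S \<and> s \<otimes>\<^bsub>G\<^esub> t = u. a s * b t * \<alpha> s t),
      one = (\<lambda>u\<in>S. if u = \<one>\<^bsub>G\<^esub> then inverse (\<alpha> \<one>\<^bsub>G\<^esub> \<one>\<^bsub>G\<^esub>) else 0),
      ring.zero = (\<lambda>u\<in>S. 0),
      add = (\<lambda>a b. \<lambda>u\<in>S. a u + b u),
      module.smult = (\<lambda>c a. \<lambda>u\<in>S. c * a u)\<rparr>"

definition basis_elem :: "'g set \<Rightarrow> 'g \<Rightarrow> 'g \<Rightarrow> 'k::field" where
  "basis_elem S s = (\<lambda>t\<in>S. if t = s then 1 else 0)"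

lemma basis_elem_mult:
  assumes "subgroup S G" "finite S" "s \<in> S" "t \<in> S"
  shows "basis_elem S s \<otimes>\<^bsub>twisted_group_algebra G S \<alpha>\<^esub> basis_elem S t
       = \<alpha> s t \<odot>\<^bsub>twisted_group_algebra G S \<alpha>\<^esub> basis_elem S (s \<otimes>\<^bsub>G\<^esub> t)"
proof (rule ext)
  fix u
  let ?P = "{(s', t'). s' \<in> S \<and> t' \<in> S \<and> s' \<otimes>\<^bsub>G\<^esub> t' = u}"
  let ?f = "\<lambda>(s', t'). basis_elem S s s' * basis_elem S t t' * \<alpha> s' t'"
  have "?P \<subseteq> S \<times> S" by auto
  then have fin: "finite ?P" using assms(2) finite_subset by blast
  have "sum ?f ?P = sum (\<lambda>p. if p = (s, t) then \<alpha> s t else 0) ?P"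
    by (rule sum.cong) (auto simp: basis_elem_def split: if_splits)
  also have "\<dots> = (if s \<otimes>\<^bsub>G\<^esub> t = u then \<alpha> s t else 0)"
    using fin assms by (simp add: sum.delta)
  finally show "(basis_elem S s \<otimes>\<^bsub>twisted_group_algebra G S \<alpha>\<^esub> basis_elem S t) u
       = (\<alpha> s t \<odot>\<^bsub>twisted_group_algebra G S \<alpha>\<^esub> basis_elem S (s \<otimes>\<^bsub>G\<^esub> t)) u"
    by (auto simp: twisted_group_algebra_def basis_elem_def)
qed

definition conj_basis ::
  "('g, 'm) monoid_scheme \<Rightarrow> 'g set \<Rightarrow> ('g \<Rightarrow> 'g \<Rightarrow> 'k::field) \<Rightarrow> 'g \<Rightarrow> ('g \<Rightarrow> 'k) \<Rightarrow> ('g \<Rightarrow> 'k)" where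
  "conj_basis G S \<alpha> s a =
     basis_elem S s \<otimes>\<^bsub>twisted_group_algebra G S \<alpha>\<^esub> a
       \<otimes>\<^bsub>twisted_group_algebra G S \<alpha>\<^esub> inv\<^bsub>twisted_group_algebra G S \<alpha>\<^esub> (basis_elem S s)"


section \<open>The Galois object and the Miyashita-Ulbrich action\<close>

definition galois_algebra ::
  "('g, 'm) monoid_scheme \<Rightarrow> 'g set \<Rightarrow> ('g \<Rightarrow> 'g \<Rightarrow> 'k::field) \<Rightarrow> ('k, 'g \<Rightarrow> 'g \<Rightarrow> 'k) module" where
  "galois_algebra G S \<alpha> =
     (function_algebra (carrier G) (twisted_group_algebra G S \<alpha>))
       \<lparr>carrier := {f \<in> carrier G \<rightarrow>\<^sub>E carrier (twisted_group_algebra G S \<alpha>).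
          \<forall>s\<in>S. \<forall>g\<in>carrier G. f (s \<otimes>\<^bsub>G\<^esub> g) = conj_basis G S \<alpha> s (f g)}\<rparr>"

definition translate :: "('g, 'm) monoid_scheme \<Rightarrow> 'g \<Rightarrow> ('g \<Rightarrow> 'b) \<Rightarrow> ('g \<Rightarrow> 'b)" where
  "translate G g f = (\<lambda>h\<in>carrier G. f (h \<otimes>\<^bsub>G\<^esub> g))"

definition invariants :: "('k, 'a) module \<Rightarrow> ('g \<Rightarrow> 'a \<Rightarrow> 'a) \<Rightarrow> 'g set \<Rightarrow> 'a set" where
  "invariants A act F = {a \<in> carrier A. \<forall>g\<in>F. act g a = a}"

text \<open>
  Let the finite group \<open>G\<close> act on the algebra \<open>A\<close> by \<open>act\<close>. The coaction of \<open>k\<^sup>G\<close> on \<open>A\<close> is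
  \<open>\<rho>(y) = \<Sum>g. act g y \<otimes> e\<^sub>g\<close>, so that the defining identity \<open>x y = y\<^sub>(\<^sub>0\<^sub>) (x \<leftharpoonup> y\<^sub>(\<^sub>1\<^sub>))\<close> of the
  Miyashita-Ulbrich action reads \<open>x y = \<Sum>g. act g y (x \<leftharpoonup> e\<^sub>g)\<close>. The linear map on
  \<open>A \<otimes> k\<^sup>G\<close> is represented by the corresponding bilinear map \<open>mu x h\<close>, meaning \<open>x \<leftharpoonup> h\<close>.
\<close>

definition is_miyashita_ulbrich ::
  "('g, 'm) monoid_scheme \<Rightarrow> ('k::field, 'a) module \<Rightarrow> ('g \<Rightarrow> 'a \<Rightarrow> 'a)
    \<Rightarrow> ('a \<Rightarrow> ('g \<Rightarrow> 'k) \<Rightarrow> 'a) \<Rightarrow> bool" where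
  "is_miyashita_ulbrich G A act mu \<longleftrightarrow>
     (let H = functions_on_group G in
       mu \<in> carrier A \<rightarrow>\<^sub>E (carrier H \<rightarrow>\<^sub>E carrier A) \<and>
       (\<forall>x\<in>carrier A. \<forall>y\<in>carrier A. \<forall>h\<in>carrier H. mu (x \<oplus>\<^bsub>A\<^esub> y) h = mu x h \<oplus>\<^bsub>A\<^esub> mu y h) \<and>
       (\<forall>x\<in>carrier A. \<forall>h\<in>carrier H. \<forall>h'\<in>carrier H. mu x (h \<oplus>\<^bsub>H\<^esub> h') = mu x h \<oplus>\<^bsub>A\<^esub> mu x h') \<and>
       (\<forall>c. \<forall>x\<in>carrier A. \<forall>h\<in>carrier H.
          mu (c \<odot>\<^bsub>A\<^esub> x) h = c \<odot>\<^bsub>A\<^esub> mu x h \<and> mu x (c \<odot>\<^bsub>H\<^esub> h) = c \<odot>\<^bsub>A\<^esub> mu x h) \<and>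
       (\<forall>x\<in>carrier A. \<forall>y\<in>carrier A.
          x \<otimes>\<^bsub>A\<^esub> y = (\<Oplus>\<^bsub>A\<^esub>g\<in>carrier G. act g y \<otimes>\<^bsub>A\<^esub> mu x (point_idem G g))))"

text \<open>The description is well defined when \<open>A\<close> is a \<open>k\<^sup>G\<close>-Galois object.\<close>

definition miyashita_ulbrich ::
  "('g, 'm) monoid_scheme \<Rightarrow> ('k::field, 'a) module \<Rightarrow> ('g \<Rightarrow> 'a \<Rightarrow> 'a) \<Rightarrow> 'a \<Rightarrow> ('g \<Rightarrow> 'k) \<Rightarrow> 'a" where
  "miyashita_ulbrich G A act = (THE mu. is_miyashita_ulbrich G A act mu)"

text \<open>
  \<open>A\<close> with the right action of \<open>k\<^sup>G\<close>. As \<open>k\<^sup>G\<close> is commutative, right modules are left modules,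
  which allows the use of the library's \<^const>\<open>submodule\<close>.
\<close>

definition miyashita_ulbrich_module ::
  "('g, 'm) monoid_scheme \<Rightarrow> ('k::field, 'a) module \<Rightarrow> ('g \<Rightarrow> 'a \<Rightarrow> 'a) \<Rightarrow> ('g \<Rightarrow> 'k, 'a) module" where
  "miyashita_ulbrich_module G A act =
     \<lparr>carrier = carrier A, monoid.mult = monoid.mult A, one = \<one>\<^bsub>A\<^esub>, ring.zero = \<zero>\<^bsub>A\<^esub>,
      add = add A, module.smult = (\<lambda>h x. miyashita_ulbrich G A act x h)\<rparr>"

end

theory Submission
  imports Defs
begin

text \<open>
  Write \<open>x\<^sub>s x\<^sub>t x\<^sub>s\<^sup>-\<^sup>1 = c(s,t) x\<^bsub>sts\<^sup>-\<^sup>1\<^esub>\<close>. The Miyashita-Ulbrich action on \<open>A(G,S,\<alpha>)\<close> is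
  \<open>(f \<leftharpoonup> p)(h) = \<Sum>\<^sub>s f(h)\<^sub>s p(h\<^sup>-\<^sup>1sh) x\<^sub>s\<close>; it is the only one because non-degeneracy makes the maps
  \<open>b \<mapsto> x\<^sub>s b v\<close> independent. If \<open>S \<subseteq> F\<close>, then an \<open>F\<close>-invariant \<open>f\<close> has central, hence scalar, values,
  and \<open>f \<leftharpoonup> p = p(1) f\<close>.

  Conversely let \<open>A\<^sup>F\<close> be stable and put \<open>T = S \<inter> F\<close>. Stability forces every \<open>s\<close> that occurs in a
  \<open>T\<close>-invariant element of \<open>k\<^sub>\<alpha>S\<close> to centralize \<open>F\<close>. Computing \<open>dim (k\<^sub>\<alpha>S)\<^sup>T\<close> by a character count
  then shows that there are exactly \<open>|S| / |T|\<close> such \<open>s\<close>. If \<open>S\<close> were not contained in \<open>F\<close>, there would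
  be such a \<open>z \<noteq> 1\<close>; as \<open>Z(G) = 1\<close> and \<open>F\<close> is a maximal subgroup, \<open>F\<close> is the centralizer of \<open>z\<close>, so the
  \<open>S\<close>-orbit of \<open>z\<close> already has \<open>|S| / |T|\<close> elements, leaving no room for \<open>1\<close>.
\<close>

section \<open>Conjugation in the twisted group algebra\<close>

locale cocycle_group = group G for G (structure) +
  fixes S :: "'a set" and \<alpha> :: "'a \<Rightarrow> 'a \<Rightarrow> 'k::field_char_0"
  assumes fin: "finite (carrier G)"
    and subgroup_S: "subgroup S G"
    and cocycle: "two_cocycle G S \<alpha>"
begin

lemma S_carrier [simp]: "s \<in> S \<Longrightarrow> s \<in> carrier G"
  using subgroup.mem_carrier[OF subgroup_S] .

lemma S_one [simp]: "\<one> \<in> S"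
  using subgroup.one_closed[OF subgroup_S] .

lemma S_mult [simp]: "s \<in> S \<Longrightarrow> t \<in> S \<Longrightarrow> s \<otimes> t \<in> S"
  using subgroup.m_closed[OF subgroup_S] .

lemma S_inv [simp]: "s \<in> S \<Longrightarrow> inv s \<in> S"
  using subgroup.m_inv_closed[OF subgroup_S] .

lemma finite_S [simp]: "finite S"
  using fin S_carrier by (meson finite_subset subsetI)

lemma mult_inv_mult [simp]:
  assumes "x \<in> carrier G" "y \<in> carrier G"
  shows "x \<otimes> (inv x \<otimes> y) = y" "inv x \<otimes> (x \<otimes> y) = y"
  using assms by (simp_all flip: m_assoc)

lemmas words = m_assoc inv_mult_group

lemma \<alpha>_nonzero [simp]: "s \<in> S \<Longrightarrow> t \<in> S \<Longrightarrow> \<alpha> s t \<noteq> 0"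
  using cocycle by (simp add: two_cocycle_def)

lemma \<alpha>_assoc:
  "s \<in> S \<Longrightarrow> t \<in> S \<Longrightarrow> u \<in> S \<Longrightarrow> \<alpha> s t * \<alpha> (s \<otimes> t) u = \<alpha> t u * \<alpha> s (t \<otimes> u)"
  using cocycle by (simp add: two_cocycle_def)

text \<open>Instance (s,1,1) of the cocycle identity, with \<open>\<alpha> s \<one>\<close>
  cancelled. As the cocycle is not normalised, \<open>\<alpha> \<one> \<one>\<close> takes the place
  of 1.\<close>

lemma \<alpha>_one_right: "s \<in> S \<Longrightarrow> \<alpha> s \<one> = \<alpha> \<one> \<one>"
  using \<alpha>_assoc[of s \<one> \<one>] by simp

lemma \<alpha>_one_left: "s \<in> S \<Longrightarrow> \<alpha> \<one> s = \<alpha> \<one> \<one>"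
  using \<alpha>_assoc[of \<one> \<one> s] by simp

lemma \<alpha>_inv_commute: "s \<in> S \<Longrightarrow> \<alpha> (inv s) s = \<alpha> s (inv s)"
  using \<alpha>_assoc[of s "inv s" s] by (simp add: \<alpha>_one_left[of s] \<alpha>_one_right[of s])

definition conjg :: "'a \<Rightarrow> 'a \<Rightarrow> 'a" where
  "conjg s t = s \<otimes> t \<otimes> inv s"

text \<open>The scalar with \<open>x\<^sub>s x\<^sub>t x\<^sub>s\<^sup>-\<^sup>1 = c s t x\<^bsub>conjg s t\<^esub>\<close>.\<close>

definition c :: "'a \<Rightarrow> 'a \<Rightarrow> 'k" where
  "c s t = \<alpha> s t / \<alpha> (conjg s t) s"

lemma conjg_closed [simp]: "s \<in> carrier G \<Longrightarrow> t \<in> carrier G \<Longrightarrow> conjg s t \<in> carrier G"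
  by (simp add: conjg_def)

lemma conjg_S [simp]: "s \<in> S \<Longrightarrow> t \<in> S \<Longrightarrow> conjg s t \<in> S"
  by (simp add: conjg_def)

lemma conjg_mult_left:
  "r \<in> carrier G \<Longrightarrow> s \<in> carrier G \<Longrightarrow> t \<in> carrier G \<Longrightarrow> conjg (r \<otimes> s) t = conjg r (conjg s t)"
  by (simp add: conjg_def words)

lemma conjg_mult_right:
  "s \<in> carrier G \<Longrightarrow> u \<in> carrier G \<Longrightarrow> v \<in> carrier G \<Longrightarrow> conjg s (u \<otimes> v) = conjg s u \<otimes> conjg s v"
  by (simp add: conjg_def words)

lemma conjg_one_left [simp]: "t \<in> carrier G \<Longrightarrow> conjg \<one> t = t"
  by (simp add: conjg_def)

lemma conjg_one_right [simp]: "s \<in> carrier G \<Longrightarrow> conjg s \<one> = \<one>"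
  by (simp add: conjg_def)

lemma conjg_inv [simp]:
  assumes "s \<in> carrier G" "t \<in> carrier G"
  shows "conjg s (conjg (inv s) t) = t" "conjg (inv s) (conjg s t) = t"
  using assms by (simp_all flip: conjg_mult_left)

lemma conjg_mult_self: "s \<in> carrier G \<Longrightarrow> t \<in> carrier G \<Longrightarrow> conjg s t \<otimes> s = s \<otimes> t"
  by (simp add: conjg_def words)

lemma conjg_cancel [simp]:
  "s \<in> carrier G \<Longrightarrow> t \<in> carrier G \<Longrightarrow> u \<in> carrier G \<Longrightarrow> conjg s t = conjg s u \<longleftrightarrow> t = u"
  using conjg_inv(2) by metis

lemma conjg_fixed_iff: "s \<in> carrier G \<Longrightarrow> t \<in> carrier G \<Longrightarrow> conjg s t = t \<longleftrightarrow> s \<otimes> t = t \<otimes> s"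
  unfolding conjg_def by (metis inv_solve_right' m_closed)

lemma bij_betw_conjg: "s \<in> S \<Longrightarrow> bij_betw (conjg s) S S"
  by (rule bij_betwI[where g = "conjg (inv s)"]) auto

lemma c_nonzero [simp]: "s \<in> S \<Longrightarrow> t \<in> S \<Longrightarrow> c s t \<noteq> 0"
  by (simp add: c_def)

lemma c_one_left [simp]: "t \<in> S \<Longrightarrow> c \<one> t = 1"
  by (simp add: c_def \<alpha>_one_left[of t] \<alpha>_one_right[of t])

lemma c_one_right [simp]: "s \<in> S \<Longrightarrow> c s \<one> = 1"
  by (simp add: c_def \<alpha>_one_left[of s] \<alpha>_one_right[of s])

text \<open>x_r x_s is a scalar multiple of x_rs, so both conjugate alike. In coefficients this
  takes three instances of the cocycle identity, with a common factor \<open>\<alpha> r s\<close>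
  cancelled at the end.\<close>

lemma c_mult_left:
  assumes [simp]: "r \<in> S" "s \<in> S" "t \<in> S"
  shows "c (r \<otimes> s) t = c r (conjg s t) * c s t"
proof -
  define t' t'' where "t' = conjg s t" and "t'' = conjg r t'"
  have [simp]: "t' \<in> S" "t'' \<in> S" by (simp_all add: t'_def t''_def)
  have e: "\<alpha> t'' r * \<alpha> (r \<otimes> t') s = \<alpha> r s * \<alpha> t'' (r \<otimes> s)"
    "\<alpha> r t' * \<alpha> (r \<otimes> t') s = \<alpha> t' s * \<alpha> r (s \<otimes> t)"
    "\<alpha> r s * \<alpha> (r \<otimes> s) t = \<alpha> s t * \<alpha> r (s \<otimes> t)"
    using \<alpha>_assoc[of t'' r s] \<alpha>_assoc[of r t' s] \<alpha>_assoc[of r s t]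
    by (simp_all add: t'_def t''_def conjg_mult_self)
  have "\<alpha> r s * (\<alpha> r t' * \<alpha> s t * \<alpha> t'' (r \<otimes> s))
      = (\<alpha> r s * \<alpha> t'' (r \<otimes> s)) * (\<alpha> r t' * \<alpha> s t)"
    by (simp only: mult_ac)
  also have "\<dots> = (\<alpha> r t' * \<alpha> (r \<otimes> t') s) * (\<alpha> t'' r * \<alpha> s t)"
    by (simp only: e(1)[symmetric] mult_ac)
  also have "\<dots> = (\<alpha> s t * \<alpha> r (s \<otimes> t)) * (\<alpha> t' s * \<alpha> t'' r)"
    by (simp only: e(2) mult_ac)
  also have "\<dots> = \<alpha> r s * (\<alpha> (r \<otimes> s) t * \<alpha> t'' r * \<alpha> t' s)"
    by (simp only: e(3)[symmetric] mult_ac)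
  finally have "\<alpha> r s * (\<alpha> r t' * \<alpha> s t * \<alpha> t'' (r \<otimes> s))
      = \<alpha> r s * (\<alpha> (r \<otimes> s) t * \<alpha> t'' r * \<alpha> t' s)" .
  then have "\<alpha> r t' * \<alpha> s t * \<alpha> t'' (r \<otimes> s) = \<alpha> (r \<otimes> s) t * \<alpha> t'' r * \<alpha> t' s"
    by simp
  then have "\<alpha> (r \<otimes> s) t / \<alpha> t'' (r \<otimes> s) = \<alpha> r t' / \<alpha> t'' r * (\<alpha> s t / \<alpha> t' s)"
    by (simp add: frac_eq_eq algebra_simps)
  then show ?thesis
    by (simp add: c_def conjg_mult_left t'_def t''_def)
qed

text \<open>Conjugation by x_s is multiplicative; its effects on the two sides of x_u x_v =
  \<alpha>(u,v) x_uv are compared.\<close>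

lemma c_mult_right:
  assumes [simp]: "s \<in> S" "u \<in> S" "v \<in> S"
  shows "c s (u \<otimes> v) * \<alpha> u v = \<alpha> (conjg s u) (conjg s v) * c s u * c s v"
proof -
  define u' v' where "u' = conjg s u" and "v' = conjg s v"
  have [simp]: "u' \<in> S" "v' \<in> S" by (simp_all add: u'_def v'_def)
  have e: "\<alpha> s u * \<alpha> (s \<otimes> u) v = \<alpha> u v * \<alpha> s (u \<otimes> v)"
    "\<alpha> u' v' * \<alpha> (u' \<otimes> v') s = \<alpha> v' s * \<alpha> u' (s \<otimes> v)"
    "\<alpha> u' s * \<alpha> (s \<otimes> u) v = \<alpha> s v * \<alpha> u' (s \<otimes> v)"
    using \<alpha>_assoc[of s u v] \<alpha>_assoc[of u' v' s] \<alpha>_assoc[of u' s v]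
    by (simp_all add: u'_def v'_def conjg_mult_self)
  have "\<alpha> s (u \<otimes> v) * \<alpha> u v * (\<alpha> u' s * \<alpha> v' s)
      = (\<alpha> u v * \<alpha> s (u \<otimes> v)) * (\<alpha> u' s * \<alpha> v' s)"
    by (simp only: mult_ac)
  also have "\<dots> = (\<alpha> u' s * \<alpha> (s \<otimes> u) v) * (\<alpha> s u * \<alpha> v' s)"
    by (simp only: e(1)[symmetric] mult_ac)
  also have "\<dots> = (\<alpha> v' s * \<alpha> u' (s \<otimes> v)) * (\<alpha> s u * \<alpha> s v)"
    by (simp only: e(3) mult_ac)
  also have "\<dots> = \<alpha> u' v' * \<alpha> s u * \<alpha> s v * \<alpha> (u' \<otimes> v') s"
    by (simp only: e(2)[symmetric] mult_ac)
  finally have "\<alpha> s (u \<otimes> v) * \<alpha> u v * (\<alpha> u' s * \<alpha> v' s)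
      = \<alpha> u' v' * \<alpha> s u * \<alpha> s v * \<alpha> (u' \<otimes> v') s" .
  then have "\<alpha> s (u \<otimes> v) / \<alpha> (u' \<otimes> v') s * \<alpha> u v = \<alpha> u' v' * (\<alpha> s u / \<alpha> u' s) * (\<alpha> s v / \<alpha> v' s)"
    by (simp add: divide_simps algebra_simps)
  then show ?thesis
    by (simp add: c_def conjg_mult_right u'_def v'_def)
qed

lemma c_commuting:
  assumes "s \<in> S" "t \<in> S" "s \<otimes> t = t \<otimes> s"
  shows "c s t = \<alpha> s t / \<alpha> t s"
  using assms conjg_fixed_iff[of s t] by (simp add: c_def)

text \<open>The cocycle values in \<open>c_mult_right\<close> cancel, so \<open>c s\<close> is a
  linear character of the centralizer of s in S.\<close>

lemma c_mult_right_commuting: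
  assumes "s \<in> S" "u \<in> S" "v \<in> S" "s \<otimes> u = u \<otimes> s" "s \<otimes> v = v \<otimes> s"
  shows "c s (u \<otimes> v) = c s u * c s v"
proof -
  have "conjg s u = u" "conjg s v = v"
    using assms by (simp_all add: conjg_fixed_iff)
  with assms(1-3) c_mult_right[of s u v] show ?thesis by simp
qed

end

section \<open>Non-degeneracy and vanishing character sums\<close>

locale nondegenerate_cocycle_group = cocycle_group G S \<alpha>
  for G (structure) and S :: "'a set" and \<alpha> :: "'a \<Rightarrow> 'a \<Rightarrow> 'k::field_char_0" +
  assumes nondegenerate: "nondegenerate_cocycle G S \<alpha>"
begin

text \<open>For commuting elements \<open>c r s\<close> and \<open>c s r\<close> are reciprocal
  ratios of \<open>\<alpha> r s\<close> and \<open>\<alpha> s r\<close>, so a failure of symmetry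
  shows in both.\<close>

lemma nondegenerateE:
  assumes "s \<in> S" "s \<noteq> \<one>"
  obtains r where "r \<in> S" "r \<otimes> s = s \<otimes> r" "c r s \<noteq> 1" "c s r \<noteq> 1"
proof -
  have "s \<notin> {s \<in> S. \<forall>t\<in>grp_centralizer G S s. \<alpha> s t = \<alpha> t s}"
    using nondegenerate assms by (simp add: nondegenerate_cocycle_def)
  then obtain r where "r \<in> S" "s \<otimes> r = r \<otimes> s" "\<alpha> s r \<noteq> \<alpha> r s"
    using assms by (auto simp: grp_centralizer_def)
  then show ?thesis
    using that[of r] assms by (simp add: c_commuting)
qed

text \<open>Replacing \<open>t\<close> by \<open>t r\<close>, with \<open>r\<close> commuting with \<open>q\<close> and \<open>c r q \<noteq> 1\<close>, multiplies the sum by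
  \<open>c r q\<close>.\<close>

lemma sum_c_conjg_eq_0:
  assumes [simp]: "q \<in> S" and "q \<noteq> \<one>"
  shows "(\<Sum>t\<in>S. c t q * \<phi> (conjg t q)) = (0::'k)"
proof -
  obtain r where [simp]: "r \<in> S" and r: "r \<otimes> q = q \<otimes> r" "c r q \<noteq> 1"
    using nondegenerateE[OF assms] .
  have [simp]: "conjg r q = q" using r by (simp add: conjg_fixed_iff)
  have bij: "bij_betw (\<lambda>t. t \<otimes> r) S S"
    by (rule bij_betwI[where g = "\<lambda>t. t \<otimes> inv r"]) (auto simp: m_assoc)
  have "(\<Sum>t\<in>S. c t q * \<phi> (conjg t q)) = (\<Sum>t\<in>S. c (t \<otimes> r) q * \<phi> (conjg (t \<otimes> r) q))"
    by (rule sum.reindex_bij_betw[OF bij, symmetric])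
  also have "\<dots> = c r q * (\<Sum>t\<in>S. c t q * \<phi> (conjg t q))"
    by (simp add: c_mult_left conjg_mult_left sum_distrib_left mult_ac)
  finally show ?thesis using r by simp
qed

lemma sum_inv_S: "(\<Sum>t\<in>S. f (inv t)) = (\<Sum>t\<in>S. f t)"
proof -
  have "bij_betw (\<lambda>t. inv t) S S"
    by (rule bij_betwI[where g = "\<lambda>t. inv t"]) auto
  then show ?thesis by (rule sum.reindex_bij_betw)
qed

end

section \<open>Coefficientwise description of the Galois object\<close>

context cocycle_group begin

abbreviation B :: "('k, 'a \<Rightarrow> 'k) module" where
  "B \<equiv> twisted_group_algebra G S \<alpha>"

lemma B_mult:
  assumes [simp]: "u \<in> S"
  shows "(a \<otimes>\<^bsub>B\<^esub> b) u = (\<Sum>s\<in>S. a s * b (inv s \<otimes> u) * \<alpha> s (inv s \<otimes> u))"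
proof -
  let ?P = "{(s, t). s \<in> S \<and> t \<in> S \<and> s \<otimes> t = u}"
  have "bij_betw (\<lambda>s. (s, inv s \<otimes> u)) S ?P"
    by (rule bij_betwI[where g = fst]) auto
  from sum.reindex_bij_betw[OF this, where g = "\<lambda>(s, t). a s * b t * \<alpha> s t"]
  show ?thesis by (simp add: twisted_group_algebra_def)
qed

lemma B_mult_extensional [simp]: "a \<otimes>\<^bsub>B\<^esub> b \<in> extensional S"
  by (simp add: twisted_group_algebra_def)

lemma basis_elem_mult_left:
  assumes [simp]: "s \<in> S" "u \<in> S"
  shows "(basis_elem S s \<otimes>\<^bsub>B\<^esub> a) u = \<alpha> s (inv s \<otimes> u) * a (inv s \<otimes> u)"
proof -
  have "(basis_elem S s \<otimes>\<^bsub>B\<^esub> a) u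
      = (\<Sum>t\<in>S. if t = s then a (inv t \<otimes> u) * \<alpha> t (inv t \<otimes> u) else 0)"
    unfolding B_mult[OF assms(2)] by (rule sum.cong) (auto simp: basis_elem_def)
  then show ?thesis by simp
qed

lemma basis_elem_mult_right:
  assumes [simp]: "s \<in> S" "u \<in> S"
  shows "(a \<otimes>\<^bsub>B\<^esub> (x \<odot>\<^bsub>B\<^esub> basis_elem S s)) u = a (u \<otimes> inv s) * x * \<alpha> (u \<otimes> inv s) s"
proof -
  have eq: "inv t \<otimes> u = s \<longleftrightarrow> t = u \<otimes> inv s" if "t \<in> S" for t
    using that by (metis S_carrier assms inv_solve_left inv_solve_right)
  have "(a \<otimes>\<^bsub>B\<^esub> (x \<odot>\<^bsub>B\<^esub> basis_elem S s)) u
      = (\<Sum>t\<in>S. if t = u \<otimes> inv s then a t * x * \<alpha> t s else 0)"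
    unfolding B_mult[OF assms(2)]
    by (rule sum.cong) (auto simp: basis_elem_def twisted_group_algebra_def eq words)
  then show ?thesis by simp
qed

text \<open>The scalar arises from x_s x_(s^-1) = \<alpha>(s,s^-1) x_1, where x_1 is
  \<open>\<alpha> \<one> \<one>\<close> times the unit.\<close>

lemma inv_basis_elem:
  assumes [simp]: "s \<in> S"
  shows "inv\<^bsub>B\<^esub> (basis_elem S s) = inverse (\<alpha> s (inv s) * \<alpha> \<one> \<one>) \<odot>\<^bsub>B\<^esub> basis_elem S (inv s)"
proof -
  define k where "k = inverse (\<alpha> s (inv s) * \<alpha> \<one> \<one>)"
  define y where "y = k \<odot>\<^bsub>B\<^esub> basis_elem S (inv s)"
  have k: "\<alpha> s (inv s) * k = inverse (\<alpha> \<one> \<one>)"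
    by (simp add: k_def)
  have one: "\<one>\<^bsub>B\<^esub> u = (if u = \<one> then inverse (\<alpha> \<one> \<one>) else 0)" if "u \<in> S" for u
    using that by (simp add: twisted_group_algebra_def)
  have y: "y u = (if u = inv s then k else 0)" if "u \<in> S" for u
    using that by (simp add: y_def twisted_group_algebra_def basis_elem_def)
  have exts: "\<one>\<^bsub>B\<^esub> \<in> extensional S" "y \<in> extensional S"
    by (simp_all add: y_def twisted_group_algebra_def)
  have carrier: "carrier B = extensional S"
    by (simp add: twisted_group_algebra_def PiE_UNIV_domain PiE_def)
  have right: "basis_elem S s \<otimes>\<^bsub>B\<^esub> y = \<one>\<^bsub>B\<^esub>"
  proof (rule extensionalityI[OF B_mult_extensional exts(1)])
    fix u assume [simp]: "u \<in> S"
    have "inv s \<otimes> u = inv s \<longleftrightarrow> u = \<one>" by simp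
    then show "(basis_elem S s \<otimes>\<^bsub>B\<^esub> y) u = \<one>\<^bsub>B\<^esub> u"
      by (simp add: basis_elem_mult_left y one k)
  qed
  have one_smult: "1 \<odot>\<^bsub>B\<^esub> basis_elem S s = basis_elem S s"
    by (rule ext) (simp add: twisted_group_algebra_def basis_elem_def)
  have left: "y \<otimes>\<^bsub>B\<^esub> basis_elem S s = \<one>\<^bsub>B\<^esub>"
  proof (rule extensionalityI[OF B_mult_extensional exts(1)])
    fix u assume [simp]: "u \<in> S"
    have "u \<otimes> inv s = inv s \<longleftrightarrow> u = \<one>" by simp
    then show "(y \<otimes>\<^bsub>B\<^esub> basis_elem S s) u = \<one>\<^bsub>B\<^esub> u"
      using basis_elem_mult_right[of s u y 1] k
      by (simp add: one_smult y one \<alpha>_inv_commute mult.commute)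
  qed
  \<comment> \<open>The inverse is a definite description, so uniqueness is needed too; the
    right-inverse equation already yields it coefficientwise.\<close>
  have unique: "z = y" if "z \<in> carrier B" and z: "basis_elem S s \<otimes>\<^bsub>B\<^esub> z = \<one>\<^bsub>B\<^esub>" for z
  proof (rule extensionalityI[OF _ exts(2)])
    show "z \<in> extensional S" using that by (simp add: carrier)
    fix u assume [simp]: "u \<in> S"
    have "\<alpha> s u * z u = (if s \<otimes> u = \<one> then inverse (\<alpha> \<one> \<one>) else 0)"
      using basis_elem_mult_left[of s "s \<otimes> u" z] by (simp add: z one)
    moreover have "s \<otimes> u = \<one> \<longleftrightarrow> u = inv s"
      by (metis S_carrier \<open>u \<in> S\<close> assms inv_equality inv_inv r_inv)
    ultimately show "z u = y u"
      by (auto simp: y k_def field_simps split: if_splits)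
  qed
  have "inv\<^bsub>B\<^esub> (basis_elem S s) = y"
    unfolding m_inv_def[of B]
    by (rule the_equality) (use right left unique in \<open>auto simp: carrier exts\<close>)
  then show ?thesis by (simp add: y_def k_def)
qed

text \<open>Identifies \<open>c\<close> as the scalar of conjugation. Evaluating at
  \<open>conjg s t\<close> keeps inverses out of the formula.\<close>

lemma conj_basis_conjg:
  assumes [simp]: "s \<in> S" "t \<in> S"
  shows "conj_basis G S \<alpha> s a (conjg s t) = c s t * a t"
proof -
  define u where "u = conjg s t"
  have [simp]: "u \<in> S" by (simp add: u_def)
  have us: "u \<otimes> s = s \<otimes> t" by (simp add: u_def conjg_mult_self)
  \<comment> \<open>The cocycle identity at (u, s, s^-1), with u s = s t, turns the scalar of the
    inverse basis element into \<open>inverse (\<alpha> u s)\<close>.\<close>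
  have "\<alpha> u s * \<alpha> (s \<otimes> t) (inv s) = \<alpha> s (inv s) * \<alpha> \<one> \<one>"
    using \<alpha>_assoc[of u s "inv s"] by (simp add: us \<alpha>_one_right[of u])
  then have k: "\<alpha> (s \<otimes> t) (inv s) * inverse (\<alpha> s (inv s) * \<alpha> \<one> \<one>) = inverse (\<alpha> u s)"
    by (simp add: field_simps)
  have "conj_basis G S \<alpha> s a u
      = \<alpha> s t * a t * (\<alpha> (s \<otimes> t) (inv s) * inverse (\<alpha> s (inv s) * \<alpha> \<one> \<one>))"
    by (simp add: conj_basis_def inv_basis_elem basis_elem_mult_right basis_elem_mult_left us)
  then show ?thesis
    unfolding k by (simp add: c_def divide_inverse flip: u_def)
qed

abbreviation A :: "('k, 'a \<Rightarrow> 'a \<Rightarrow> 'k) module" where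
  "A \<equiv> galois_algebra G S \<alpha>"

text \<open>\<open>conjg s\<close> permutes S, so equivariance at the points
  \<open>conjg s t\<close> covers every coefficient.\<close>

lemma A_carrier_iff:
  "f \<in> carrier A \<longleftrightarrow> f \<in> carrier G \<rightarrow>\<^sub>E (S \<rightarrow>\<^sub>E UNIV) \<and>
     (\<forall>s\<in>S. \<forall>g\<in>carrier G. \<forall>t\<in>S. f (s \<otimes> g) (conjg s t) = c s t * f g t)"
proof -
  have "f (s \<otimes> g) = conj_basis G S \<alpha> s (f g) \<longleftrightarrow> (\<forall>t\<in>S. f (s \<otimes> g) (conjg s t) = c s t * f g t)"
    if f: "f \<in> carrier G \<rightarrow>\<^sub>E (S \<rightarrow>\<^sub>E UNIV)" and [simp]: "s \<in> S" "g \<in> carrier G" for s g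
  proof
    assume eq: "\<forall>t\<in>S. f (s \<otimes> g) (conjg s t) = c s t * f g t"
    show "f (s \<otimes> g) = conj_basis G S \<alpha> s (f g)"
    proof (rule extensionalityI[of _ S])
      show "f (s \<otimes> g) \<in> extensional S" using PiE_mem[OF f, of "s \<otimes> g"] by (simp add: PiE_def)
      show "conj_basis G S \<alpha> s (f g) \<in> extensional S" by (simp add: conj_basis_def)
      fix u assume u: "u \<in> S"
      then have "f (s \<otimes> g) (conjg s (conjg (inv s) u)) = conj_basis G S \<alpha> s (f g) (conjg s (conjg (inv s) u))"
        by (subst eq[rule_format], simp, subst conj_basis_conjg, simp_all del: conjg_inv)
      with u show "f (s \<otimes> g) u = conj_basis G S \<alpha> s (f g) u" by simp
    qed
  qed (simp add: conj_basis_conjg)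
  then show ?thesis
    by (auto simp: galois_algebra_def twisted_group_algebra_def function_algebra_def)
qed

lemma A_carrier_equivariant:
  "f \<in> carrier A \<Longrightarrow> s \<in> S \<Longrightarrow> g \<in> carrier G \<Longrightarrow> t \<in> S \<Longrightarrow> f (s \<otimes> g) (conjg s t) = c s t * f g t"
  by (simp add: A_carrier_iff)

lemma A_carrierI:
  assumes "f \<in> extensional (carrier G)" "\<And>g. g \<in> carrier G \<Longrightarrow> f g \<in> extensional S"
    and "\<And>s g t. s \<in> S \<Longrightarrow> g \<in> carrier G \<Longrightarrow> t \<in> S \<Longrightarrow> f (s \<otimes> g) (conjg s t) = c s t * f g t"
  shows "f \<in> carrier A"
  using assms by (auto simp: A_carrier_iff PiE_def)

lemma A_eqI:
  assumes f: "f \<in> carrier A" and f': "f' \<in> carrier A"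
    and eq: "\<And>g s. g \<in> carrier G \<Longrightarrow> s \<in> S \<Longrightarrow> f g s = f' g s"
  shows "f = f'"
proof (rule extensionalityI[of _ "carrier G"])
  show "f \<in> extensional (carrier G)" "f' \<in> extensional (carrier G)"
    using f f' by (auto simp: A_carrier_iff PiE_def)
  fix g assume g: "g \<in> carrier G"
  show "f g = f' g"
  proof (rule extensionalityI[of _ S])
    show "f g \<in> extensional S" "f' g \<in> extensional S"
      using f f' g by (auto simp: A_carrier_iff PiE_def Pi_def)
  qed (use eq g in auto)
qed

lemma A_add: "g \<in> carrier G \<Longrightarrow> s \<in> S \<Longrightarrow> (x \<oplus>\<^bsub>A\<^esub> y) g s = x g s + y g s"
  and A_zero: "g \<in> carrier G \<Longrightarrow> s \<in> S \<Longrightarrow> \<zero>\<^bsub>A\<^esub> g s = 0"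
  and A_smult: "g \<in> carrier G \<Longrightarrow> s \<in> S \<Longrightarrow> (k \<odot>\<^bsub>A\<^esub> x) g s = k * x g s"
  and A_mult: "g \<in> carrier G \<Longrightarrow> s \<in> S \<Longrightarrow>
    (x \<otimes>\<^bsub>A\<^esub> y) g s = (\<Sum>r\<in>S. x g r * y g (inv r \<otimes> s) * \<alpha> r (inv r \<otimes> s))"
  by (simp_all add: galois_algebra_def function_algebra_def B_mult)
    (simp_all add: twisted_group_algebra_def)

lemma translate_apply: "h \<in> carrier G \<Longrightarrow> translate G g f h = f (h \<otimes> g)"
  by (simp add: translate_def)

lemmas A_simps = A_add A_zero A_smult A_mult translate_apply

lemma A_zero_closed [simp]: "\<zero>\<^bsub>A\<^esub> \<in> carrier A"
  by (rule A_carrierI) (auto simp: A_zero,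
    auto simp: galois_algebra_def function_algebra_def twisted_group_algebra_def)

lemma A_add_closed [simp]: "x \<in> carrier A \<Longrightarrow> y \<in> carrier A \<Longrightarrow> x \<oplus>\<^bsub>A\<^esub> y \<in> carrier A"
  by (rule A_carrierI) (auto simp: A_add A_carrier_equivariant distrib_left,
    auto simp: galois_algebra_def function_algebra_def twisted_group_algebra_def)

lemma A_smult_closed [simp]: "x \<in> carrier A \<Longrightarrow> k \<odot>\<^bsub>A\<^esub> x \<in> carrier A"
  by (rule A_carrierI) (auto simp: A_smult A_carrier_equivariant,
    auto simp: galois_algebra_def function_algebra_def twisted_group_algebra_def)

text \<open>Reindexing the convolution by \<open>conjg s\<close> leaves exactly the terms that
  \<open>c_mult_right\<close> compares.\<close>

lemma A_mult_closed [simp]: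
  assumes x: "x \<in> carrier A" and y: "y \<in> carrier A"
  shows "x \<otimes>\<^bsub>A\<^esub> y \<in> carrier A"
proof (rule A_carrierI)
  show "x \<otimes>\<^bsub>A\<^esub> y \<in> extensional (carrier G)"
    by (simp add: galois_algebra_def function_algebra_def)
  show "(x \<otimes>\<^bsub>A\<^esub> y) g \<in> extensional S" if "g \<in> carrier G" for g
    using that B_mult_extensional by (simp add: galois_algebra_def function_algebra_def)
  fix s g t assume [simp]: "s \<in> S" "g \<in> carrier G" "t \<in> S"
  let ?f = "\<lambda>r. x (s \<otimes> g) r * y (s \<otimes> g) (inv r \<otimes> conjg s t) * \<alpha> r (inv r \<otimes> conjg s t)"
  have "(x \<otimes>\<^bsub>A\<^esub> y) (s \<otimes> g) (conjg s t) = (\<Sum>r\<in>S. ?f (conjg s r))"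
    by (simp add: A_mult sum.reindex_bij_betw[OF bij_betw_conjg, of s ?f])
  also have "\<dots> = (\<Sum>r\<in>S. c s t * (x g r * y g (inv r \<otimes> t) * \<alpha> r (inv r \<otimes> t)))"
  proof (rule sum.cong)
    fix r assume [simp]: "r \<in> S"
    have e: "inv (conjg s r) \<otimes> conjg s t = conjg s (inv r \<otimes> t)"
      by (simp add: conjg_def words)
    show "?f (conjg s r) = c s t * (x g r * y g (inv r \<otimes> t) * \<alpha> r (inv r \<otimes> t))"
      using c_mult_right[of s r "inv r \<otimes> t"]
      by (simp add: e A_carrier_equivariant[OF x] A_carrier_equivariant[OF y] mult_ac)
  qed simp
  finally show "(x \<otimes>\<^bsub>A\<^esub> y) (s \<otimes> g) (conjg s t) = c s t * (x \<otimes>\<^bsub>A\<^esub> y) g t"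
    by (simp add: A_mult sum_distrib_left)
qed

lemma translate_closed [simp]:
  "g \<in> carrier G \<Longrightarrow> x \<in> carrier A \<Longrightarrow> translate G g x \<in> carrier A"
  by (rule A_carrierI)
    (auto simp: translate_apply m_assoc A_carrier_equivariant,
     auto simp: translate_def A_carrier_iff PiE_def Pi_def)

lemma abelian_group_A: "abelian_group A"
proof (rule abelian_groupI)
  fix x assume x: "x \<in> carrier A"
  show "\<exists>y\<in>carrier A. y \<oplus>\<^bsub>A\<^esub> x = \<zero>\<^bsub>A\<^esub>"
    using x by (intro bexI[of _ "(-1) \<odot>\<^bsub>A\<^esub> x"] A_eqI) (auto simp: A_simps)
qed (auto intro!: A_eqI simp: A_simps)

lemma A_finsum:
  assumes "finite I" and "\<And>i. i \<in> I \<Longrightarrow> f i \<in> carrier A" and "g \<in> carrier G" "s \<in> S"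
  shows "(\<Oplus>\<^bsub>A\<^esub>i\<in>I. f i) g s = (\<Sum>i\<in>I. f i g s)"
proof -
  interpret A: abelian_group A by (rule abelian_group_A)
  show ?thesis
    using assms(1,2) by induction (auto simp: A_simps assms(3,4) Pi_def)
qed

end

section \<open>The Miyashita-Ulbrich action\<close>

context cocycle_group begin

text \<open>The grading behind the formula: the x_s-coefficient at h has degree h^-1 s h, so A_g
  consists of the f whose value at h is a multiple of x_(h g h^-1), read as 0 off S.\<close>

definition mu :: "('a \<Rightarrow> 'a \<Rightarrow> 'k) \<Rightarrow> ('a \<Rightarrow> 'k) \<Rightarrow> 'a \<Rightarrow> 'a \<Rightarrow> 'k" where
  "mu = (\<lambda>x\<in>carrier A. \<lambda>p\<in>carrier (functions_on_group G).
     \<lambda>h\<in>carrier G. \<lambda>s\<in>S. x h s * p (conjg (inv h) s))"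

lemma functions_on_group_simps:
  "carrier (functions_on_group G) = extensional (carrier G)"
  "g \<in> carrier G \<Longrightarrow> (p \<oplus>\<^bsub>functions_on_group G\<^esub> q) g = (p g + q g :: 'k)"
  "g \<in> carrier G \<Longrightarrow> (k \<odot>\<^bsub>functions_on_group G\<^esub> p) g = k * p g"
  "p \<oplus>\<^bsub>functions_on_group G\<^esub> q \<in> extensional (carrier G)"
  "k \<odot>\<^bsub>functions_on_group G\<^esub> p \<in> extensional (carrier G)"
  by (simp_all add: functions_on_group_def function_algebra_def scalar_algebra_def PiE_UNIV_domain PiE_def)

lemma point_idem_closed [simp]: "point_idem G g \<in> extensional (carrier G)"
  by (simp add: point_idem_def)

lemma mu_apply:
  "x \<in> carrier A \<Longrightarrow> p \<in> extensional (carrier G) \<Longrightarrow> h \<in> carrier G \<Longrightarrow> s \<in> S \<Longrightarrow>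
    mu x p h s = x h s * p (conjg (inv h) s)"
  by (simp add: mu_def functions_on_group_simps)

lemma mu_closed [simp]:
  assumes "x \<in> carrier A" "p \<in> extensional (carrier G)"
  shows "mu x p \<in> carrier A"
proof (rule A_carrierI)
  fix s g t assume [simp]: "s \<in> S" "g \<in> carrier G" "t \<in> S"
  \<comment> \<open>Passing from (g, t) to (s g, s t s^-1) does not change the degree.\<close>
  have "conjg (inv (s \<otimes> g)) (conjg s t) = conjg (inv g) t"
    by (simp add: conjg_def words)
  then show "mu x p (s \<otimes> g) (conjg s t) = c s t * mu x p g t"
    using assms by (simp add: mu_apply A_carrier_equivariant)
qed (use assms in \<open>simp_all add: mu_def functions_on_group_simps\<close>)

text \<open>Since x_w b = (w \<rhd> b) x_w, moving x_w past y(h) gives y(w h), which is the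
  translate of y by the degree h^-1 w h, evaluated at h.\<close>

lemma mu_galois:
  assumes x: "x \<in> carrier A" and y: "y \<in> carrier A"
  shows "x \<otimes>\<^bsub>A\<^esub> y = (\<Oplus>\<^bsub>A\<^esub>g\<in>carrier G. translate G g y \<otimes>\<^bsub>A\<^esub> mu x (point_idem G g))"
    (is "_ = ?r")
proof (rule A_eqI)
  interpret A: abelian_group A by (rule abelian_group_A)
  show "x \<otimes>\<^bsub>A\<^esub> y \<in> carrier A" using x y by simp
  show "?r \<in> carrier A" using x y by (intro A.finsum_closed) auto
  fix h u assume [simp]: "h \<in> carrier G" "u \<in> S"
  \<comment> \<open>The sum is rewritten over the right-hand factor w = v^-1 u, the index that
    carries the degree.\<close>
  have bij: "bij_betw (\<lambda>w. u \<otimes> inv w) S S"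
    by (rule bij_betwI[where g = "\<lambda>v. inv v \<otimes> u"]) (auto simp: words)
  have "?r h u = (\<Sum>g\<in>carrier G. \<Sum>v\<in>S.
      y (h \<otimes> g) v * mu x (point_idem G g) h (inv v \<otimes> u) * \<alpha> v (inv v \<otimes> u))"
    using x y fin by (simp add: A_finsum A_mult translate_apply)
  also have "\<dots> = (\<Sum>v\<in>S. \<Sum>g\<in>carrier G.
      y (h \<otimes> g) v * mu x (point_idem G g) h (inv v \<otimes> u) * \<alpha> v (inv v \<otimes> u))"
    by (rule sum.swap)
  also have "\<dots> = (\<Sum>w\<in>S. \<Sum>g\<in>carrier G.
      y (h \<otimes> g) (u \<otimes> inv w) * mu x (point_idem G g) h w * \<alpha> (u \<otimes> inv w) w)"
    by (subst sum.reindex_bij_betw[OF bij, symmetric], rule sum.cong) (simp_all add: words)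
  also have "\<dots> = (\<Sum>w\<in>S. x h w * y h (inv w \<otimes> u) * \<alpha> w (inv w \<otimes> u))"
  proof (rule sum.cong)
    fix w assume [simp]: "w \<in> S"
    have *: "h \<otimes> conjg (inv h) w = w \<otimes> h" "conjg w (inv w \<otimes> u) = u \<otimes> inv w"
      by (simp_all add: conjg_def words)
    have "(\<Sum>g\<in>carrier G. y (h \<otimes> g) (u \<otimes> inv w) * mu x (point_idem G g) h w * \<alpha> (u \<otimes> inv w) w)
        = (\<Sum>g\<in>carrier G. if g = conjg (inv h) w
            then y (h \<otimes> g) (u \<otimes> inv w) * x h w * \<alpha> (u \<otimes> inv w) w else 0)"
      using x by (intro sum.cong) (auto simp: mu_apply point_idem_def)
    also have "\<dots> = y (w \<otimes> h) (u \<otimes> inv w) * x h w * \<alpha> (u \<otimes> inv w) w"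
      using fin by (simp add: *)
    also have "y (w \<otimes> h) (u \<otimes> inv w) = c w (inv w \<otimes> u) * y h (inv w \<otimes> u)"
      using A_carrier_equivariant[OF y, of w h "inv w \<otimes> u"] by (simp add: *)
    finally show "(\<Sum>g\<in>carrier G. y (h \<otimes> g) (u \<otimes> inv w) * mu x (point_idem G g) h w * \<alpha> (u \<otimes> inv w) w)
        = x h w * y h (inv w \<otimes> u) * \<alpha> w (inv w \<otimes> u)"
      by (simp add: c_def *)
  qed simp
  finally show "(x \<otimes>\<^bsub>A\<^esub> y) h u = ?r h u"
    by (simp add: A_mult)
qed

lemma mu_is_miyashita_ulbrich: "is_miyashita_ulbrich G A (translate G) mu"
  unfolding is_miyashita_ulbrich_def Let_def
proof (intro conjI ballI allI)
  show "mu \<in> carrier A \<rightarrow>\<^sub>E carrier (functions_on_group G) \<rightarrow>\<^sub>E carrier A"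
    using mu_closed by (auto simp: mu_def functions_on_group_simps)
qed (simp_all add: mu_galois functions_on_group_simps,
  (rule A_eqI; simp add: mu_apply A_simps functions_on_group_simps algebra_simps)+)

text \<open>The function supported on \<open>S k\<close> whose value at \<open>k\<close> is \<open>x\<^sub>t\<close>.\<close>

definition induced :: "'a \<Rightarrow> 'a \<Rightarrow> 'a \<Rightarrow> 'a \<Rightarrow> 'k" where
  "induced k t = (\<lambda>g\<in>carrier G. \<lambda>v\<in>S.
     let s = g \<otimes> inv k in if s \<in> S \<and> v = conjg s t then c s t else 0)"

lemma induced_apply:
  "g \<in> carrier G \<Longrightarrow> v \<in> S \<Longrightarrow>
    induced k t g v = (if g \<otimes> inv k \<in> S \<and> v = conjg (g \<otimes> inv k) t then c (g \<otimes> inv k) t else 0)"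
  by (simp add: induced_def Let_def)

text \<open>Membership of g k^-1 in S depends only on the coset S g, and \<open>c_mult_left\<close>
  makes the scalars equivariant.\<close>

lemma induced_closed [simp]:
  assumes [simp]: "k \<in> carrier G" "t \<in> S"
  shows "induced k t \<in> carrier A"
proof (rule A_carrierI)
  fix s g v assume [simp]: "s \<in> S" "g \<in> carrier G" "v \<in> S"
  have mem: "s \<otimes> (g \<otimes> inv k) \<in> S \<longleftrightarrow> g \<otimes> inv k \<in> S"
    using S_mult[of "inv s" "s \<otimes> (g \<otimes> inv k)"] by auto
  have "conjg s v = conjg (s \<otimes> (g \<otimes> inv k)) t \<longleftrightarrow> v = conjg (g \<otimes> inv k) t"
    by (simp add: conjg_mult_left)
  moreover have "c (s \<otimes> (g \<otimes> inv k)) t = c s (conjg (g \<otimes> inv k) t) * c (g \<otimes> inv k) t"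
    if "g \<otimes> inv k \<in> S" using that by (simp add: c_mult_left)
  ultimately show "induced k t (s \<otimes> g) (conjg s v) = c s v * induced k t g v"
    using mem by (simp add: induced_apply m_assoc)
qed (simp_all add: induced_def)

end

section \<open>Linear independence behind the uniqueness of the action\<close>

context nondegenerate_cocycle_group begin

text \<open>Coefficientwise form of \<open>\<alpha>(r, q) x\<^sub>s x\<^sub>t x\<^sub>n = x\<^sub>r x\<^sub>q x\<^sub>t x\<^sub>n\<close> with \<open>s = r q\<close>, where \<open>x\<^sub>q x\<^sub>t\<close> is
  rewritten as \<open>c(t\<^sup>-\<^sup>1, q) x\<^sub>t x\<^bsub>q'\<^esub>\<close> with \<open>q' = t\<^sup>-\<^sup>1 q t\<close>.\<close>

lemma \<alpha>_conjugate_move: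
  assumes [simp]: "r \<in> S" "q \<in> S" "t \<in> S" "n \<in> S"
  defines "q' \<equiv> conjg (inv t) q"
  shows "\<alpha> (r \<otimes> q) t * \<alpha> (r \<otimes> q \<otimes> t) n * \<alpha> r q
    = \<alpha> r t * \<alpha> (r \<otimes> t) (q' \<otimes> n) * (c (inv t) q * \<alpha> q' n)"
proof -
  have [simp]: "q' \<in> S" by (simp add: q'_def)
  have tq: "t \<otimes> q' = q \<otimes> t" by (simp add: q'_def conjg_def words)
  have "c t q' * c (inv t) q = 1"
    using c_mult_left[of t "inv t" q] by (simp add: q'_def)
  moreover have "c t q' = \<alpha> t q' / \<alpha> q t"
    by (simp add: c_def q'_def)
  ultimately have cq: "\<alpha> t q' * c (inv t) q = \<alpha> q t"
    by (simp add: field_simps)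
  have e: "\<alpha> r q * \<alpha> (r \<otimes> q) t = \<alpha> q t * \<alpha> r (q \<otimes> t)"
    "\<alpha> r t * \<alpha> (r \<otimes> t) q' = \<alpha> t q' * \<alpha> r (q \<otimes> t)"
    "\<alpha> (r \<otimes> t) q' * \<alpha> (r \<otimes> q \<otimes> t) n = \<alpha> q' n * \<alpha> (r \<otimes> t) (q' \<otimes> n)"
    using \<alpha>_assoc[of r q t] \<alpha>_assoc[of r t q'] \<alpha>_assoc[of "r \<otimes> t" q' n]
    by (simp_all add: tq m_assoc)
  have "\<alpha> (r \<otimes> q) t * \<alpha> (r \<otimes> q \<otimes> t) n * \<alpha> r q
      = (\<alpha> q t * \<alpha> r (q \<otimes> t)) * \<alpha> (r \<otimes> q \<otimes> t) n"
    by (simp only: e(1)[symmetric] mult_ac)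
  also have "\<dots> = (\<alpha> t q' * \<alpha> r (q \<otimes> t)) * (\<alpha> (r \<otimes> q \<otimes> t) n * c (inv t) q)"
    by (simp only: cq[symmetric] mult_ac)
  also have "\<dots> = (\<alpha> (r \<otimes> t) q' * \<alpha> (r \<otimes> q \<otimes> t) n) * (\<alpha> r t * c (inv t) q)"
    by (simp only: e(2)[symmetric] mult_ac)
  also have "\<dots> = \<alpha> r t * \<alpha> (r \<otimes> t) (q' \<otimes> n) * (c (inv t) q * \<alpha> q' n)"
    by (simp only: e(3) mult_ac)
  finally show ?thesis .
qed

text \<open>The maps \<open>b \<mapsto> x\<^sub>s b v\<close> are linearly independent: multiplying \<open>\<Sum>\<^sub>s x\<^sub>s x\<^sub>t v\<^sub>s = 0\<close> on the left by
  \<open>(x\<^sub>r x\<^sub>t)\<^sup>-\<^sup>1\<close> and summing over \<open>t\<close> leaves only the term \<open>s = r\<close>.\<close>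

lemma twisted_independence:
  fixes v :: "'a \<Rightarrow> 'a \<Rightarrow> 'k"
  assumes zero: "\<And>t u. t \<in> S \<Longrightarrow> u \<in> S \<Longrightarrow>
      (\<Sum>s\<in>S. \<alpha> s t * \<alpha> (s \<otimes> t) (inv (s \<otimes> t) \<otimes> u) * v s (inv (s \<otimes> t) \<otimes> u)) = 0"
    and [simp]: "r \<in> S" "m \<in> S"
  shows "v r m = 0"
proof -
  \<comment> \<open>What remains of the term s = r q once the common factor is split off. The second
    argument will be a conjugate of q, the form that \<open>sum_c_conjg_eq_0\<close>
    requires.\<close>
  define \<phi> where "\<phi> q q' = \<alpha> q' (inv q' \<otimes> m) * v (r \<otimes> q) (inv q' \<otimes> m) / \<alpha> r q" for q q'
  have bij: "bij_betw (\<lambda>q. r \<otimes> q) S S"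
    by (rule bij_betwI[where g = "\<lambda>s. inv r \<otimes> s"]) auto
  have 1: "(\<Sum>q\<in>S. c (inv t) q * \<phi> q (conjg (inv t) q)) = 0" if [simp]: "t \<in> S" for t
  proof -
    \<comment> \<open>This coefficient of the relation becomes coefficient m after division by x_r
      x_t.\<close>
    define u where "u = r \<otimes> t \<otimes> m"
    have [simp]: "u \<in> S" by (simp add: u_def)
    have "0 = (\<Sum>q\<in>S. \<alpha> (r \<otimes> q) t * \<alpha> (r \<otimes> q \<otimes> t) (inv (r \<otimes> q \<otimes> t) \<otimes> u) * v (r \<otimes> q) (inv (r \<otimes> q \<otimes> t) \<otimes> u))"
      by (subst zero[of t u, symmetric], simp, simp)
        (rule sum.reindex_bij_betw[OF bij, symmetric])
    also have "\<dots> = (\<Sum>q\<in>S. \<alpha> r t * \<alpha> (r \<otimes> t) m * (c (inv t) q * \<phi> q (conjg (inv t) q)))"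
    proof (rule sum.cong)
      fix q assume [simp]: "q \<in> S"
      define q' n where "q' = conjg (inv t) q" and "n = inv q' \<otimes> m"
      have [simp]: "q' \<in> S" "n \<in> S" by (simp_all add: q'_def n_def)
      have n: "inv (r \<otimes> q \<otimes> t) \<otimes> u = n"
        by (simp add: n_def q'_def u_def conjg_def words)
      have "\<alpha> (r \<otimes> q) t * \<alpha> (r \<otimes> q \<otimes> t) n
          = \<alpha> r t * \<alpha> (r \<otimes> t) m * (c (inv t) q * \<alpha> q' n) / \<alpha> r q"
        using \<alpha>_conjugate_move[of r q t n] by (simp add: n_def field_simps flip: q'_def)
      then show "\<alpha> (r \<otimes> q) t * \<alpha> (r \<otimes> q \<otimes> t) (inv (r \<otimes> q \<otimes> t) \<otimes> u) * v (r \<otimes> q) (inv (r \<otimes> q \<otimes> t) \<otimes> u)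
          = \<alpha> r t * \<alpha> (r \<otimes> t) m * (c (inv t) q * \<phi> q (conjg (inv t) q))"
        unfolding n by (simp add: \<phi>_def flip: q'_def n_def)
    qed simp
    finally show ?thesis by (simp flip: sum_distrib_left)
  qed
  have "0 = (\<Sum>t\<in>S. \<Sum>q\<in>S. c (inv t) q * \<phi> q (conjg (inv t) q))"
    by (simp add: 1)
  also have "\<dots> = (\<Sum>q\<in>S. \<Sum>t\<in>S. c t q * \<phi> q (conjg t q))"
    by (subst sum.swap) (simp add: sum_inv_S[of "\<lambda>t. c t q * \<phi> q (conjg t q)" for q])
  also have "\<dots> = (\<Sum>q\<in>S. if q = \<one> then of_nat (card S) * \<phi> \<one> \<one> else 0)"
    by (rule sum.cong) (auto simp: sum_c_conjg_eq_0)
  also have "\<dots> = of_nat (card S) * \<phi> \<one> \<one>"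
    by simp
  \<comment> \<open>S is nonempty and the characteristic is zero, so \<open>card S\<close> is
    invertible.\<close>
  finally have "\<phi> \<one> \<one> = 0"
    using S_one by (auto simp del: S_one)
  then show ?thesis by (simp add: \<phi>_def)
qed

text \<open>For the test function y = \<open>induced k t\<close>, y(h g) vanishes unless g = h^-1 s
  k with s in S. At h the relation thus becomes a sum over S of the kind treated in
  \<open>twisted_independence\<close>.\<close>

lemma galois_independence:
  assumes z: "\<And>g. g \<in> carrier G \<Longrightarrow> z g \<in> carrier A"
    and zero: "\<And>y. y \<in> carrier A \<Longrightarrow> (\<Oplus>\<^bsub>A\<^esub>g\<in>carrier G. translate G g y \<otimes>\<^bsub>A\<^esub> z g) = \<zero>\<^bsub>A\<^esub>"
    and [simp]: "g \<in> carrier G"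
  shows "z g = \<zero>\<^bsub>A\<^esub>"
proof (rule A_eqI)
  fix h w assume [simp]: "h \<in> carrier G" "w \<in> S"
  \<comment> \<open>With this k, the given g is the index belonging to s = 1.\<close>
  define k where "k = h \<otimes> g"
  have [simp]: "k \<in> carrier G" by (simp add: k_def)
  \<comment> \<open>\<open>v s\<close> lists the coefficients of x_s^-1 z(h), where z is taken at
    index h^-1 s k.\<close>
  define v where "v s n = z (inv h \<otimes> s \<otimes> k) h (s \<otimes> n) / \<alpha> s n" for s n
  have "v \<one> w = 0"
  proof (rule twisted_independence)
    fix t u assume [simp]: "t \<in> S" "u \<in> S"
    let ?f = "\<lambda>g. \<Sum>r\<in>S. induced k t (h \<otimes> g) r * z g h (inv r \<otimes> u) * \<alpha> r (inv r \<otimes> u)"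
    have "0 = (\<Sum>g\<in>carrier G. ?f g)"
      using arg_cong[OF zero[of "induced k t"], of "\<lambda>f. f h u"] z fin
      by (simp add: A_finsum A_mult A_zero translate_apply)
    also have "\<dots> = (\<Sum>g\<in>(\<lambda>s. inv h \<otimes> s \<otimes> k) ` S. ?f g)"
    proof (rule sum.mono_neutral_right)
      show "\<forall>g\<in>carrier G - (\<lambda>s. inv h \<otimes> s \<otimes> k) ` S. ?f g = 0"
      proof
        fix g assume g: "g \<in> carrier G - (\<lambda>s. inv h \<otimes> s \<otimes> k) ` S"
        then have "g = inv h \<otimes> (h \<otimes> g \<otimes> inv k) \<otimes> k" by (simp add: words)
        with g have "h \<otimes> g \<otimes> inv k \<notin> S" by blast
        with g show "?f g = 0" by (simp add: induced_apply)
      qed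
    qed (use fin in auto)
    also have "\<dots> = (\<Sum>s\<in>S. ?f (inv h \<otimes> s \<otimes> k))"
      by (rule sum.reindex_cong[OF _ refl refl]) (auto simp: inj_on_def)
    also have "\<dots> = (\<Sum>s\<in>S. \<alpha> s t * \<alpha> (s \<otimes> t) (inv (s \<otimes> t) \<otimes> u) * v s (inv (s \<otimes> t) \<otimes> u))"
    proof (rule sum.cong)
      fix s assume [simp]: "s \<in> S"
      define n where "n = inv (s \<otimes> t) \<otimes> u"
      have [simp]: "n \<in> S" by (simp add: n_def)
      have n: "inv (conjg s t) \<otimes> u = s \<otimes> n"
        by (simp add: n_def conjg_def words)
      have "\<alpha> (conjg s t) s * \<alpha> (s \<otimes> t) n = \<alpha> s n * \<alpha> (conjg s t) (s \<otimes> n)"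
        using \<alpha>_assoc[of "conjg s t" s n] by (simp add: conjg_mult_self)
      then have e: "c s t * \<alpha> (conjg s t) (s \<otimes> n) = \<alpha> s t * \<alpha> (s \<otimes> t) n / \<alpha> s n"
        by (simp add: c_def field_simps)
      have "?f (inv h \<otimes> s \<otimes> k) = (\<Sum>r\<in>S. if r = conjg s t
          then c s t * z (inv h \<otimes> s \<otimes> k) h (inv r \<otimes> u) * \<alpha> r (inv r \<otimes> u) else 0)"
        by (rule sum.cong) (simp_all add: induced_apply words)
      also have "\<dots> = (c s t * \<alpha> (conjg s t) (s \<otimes> n)) * z (inv h \<otimes> s \<otimes> k) h (s \<otimes> n)"
        by (simp add: n)
      also have "\<dots> = \<alpha> s t * \<alpha> (s \<otimes> t) n * v s n"
        unfolding e by (simp add: v_def)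
      finally show "?f (inv h \<otimes> s \<otimes> k) = \<alpha> s t * \<alpha> (s \<otimes> t) (inv (s \<otimes> t) \<otimes> u) * v s (inv (s \<otimes> t) \<otimes> u)"
        by (simp only: n_def)
    qed simp
    finally show "(\<Sum>s\<in>S. \<alpha> s t * \<alpha> (s \<otimes> t) (inv (s \<otimes> t) \<otimes> u) * v s (inv (s \<otimes> t) \<otimes> u)) = 0"
      by simp
  qed simp_all
  then show "z g h w = \<zero>\<^bsub>A\<^esub> h w"
    by (simp add: v_def k_def A_zero)
qed (simp_all add: z)

end

section \<open>Uniqueness of the Miyashita-Ulbrich action\<close>

context nondegenerate_cocycle_group begin

text \<open>The defining identity sees only the values at the e_g; subtracting it for two solutions
  leaves a relation to which \<open>galois_independence\<close> applies.\<close>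

lemma mu_unique_point_idem:
  assumes m: "is_miyashita_ulbrich G A (translate G) m"
    and x: "x \<in> carrier A" and [simp]: "g \<in> carrier G"
  shows "m x (point_idem G g) = mu x (point_idem G g)"
proof -
  have closed [simp]: "m x p \<in> carrier A" if "p \<in> extensional (carrier G)" for p
    using m that x by (auto simp: is_miyashita_ulbrich_def Let_def functions_on_group_simps)
  define z where "z g = m x (point_idem G g) \<oplus>\<^bsub>A\<^esub> (-1) \<odot>\<^bsub>A\<^esub> mu x (point_idem G g)" for g
  have "z g = \<zero>\<^bsub>A\<^esub>"
  proof (rule galois_independence[where z = z])
    show z: "z g \<in> carrier A" for g
      using x by (simp add: z_def)
    fix y assume y: "y \<in> carrier A"
    interpret A: abelian_group A by (rule abelian_group_A)
    show "(\<Oplus>\<^bsub>A\<^esub>g\<in>carrier G. translate G g y \<otimes>\<^bsub>A\<^esub> z g) = \<zero>\<^bsub>A\<^esub>"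
    proof (rule A_eqI)
      show "(\<Oplus>\<^bsub>A\<^esub>g\<in>carrier G. translate G g y \<otimes>\<^bsub>A\<^esub> z g) \<in> carrier A"
        using y z by (intro A.finsum_closed) auto
      fix h u assume [simp]: "h \<in> carrier G" "u \<in> S"
      have diff: "(a \<otimes>\<^bsub>A\<^esub> z g) h u
          = (a \<otimes>\<^bsub>A\<^esub> m x (point_idem G g)) h u - (a \<otimes>\<^bsub>A\<^esub> mu x (point_idem G g)) h u" for a g
        by (simp add: z_def A_simps algebra_simps flip: sum_subtractf)
      have "x \<otimes>\<^bsub>A\<^esub> y = (\<Oplus>\<^bsub>A\<^esub>g\<in>carrier G. translate G g y \<otimes>\<^bsub>A\<^esub> m x (point_idem G g))"
        using m x y by (auto simp: is_miyashita_ulbrich_def Let_def)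
      then have "(\<Oplus>\<^bsub>A\<^esub>g\<in>carrier G. translate G g y \<otimes>\<^bsub>A\<^esub> m x (point_idem G g)) h u
          = (\<Oplus>\<^bsub>A\<^esub>g\<in>carrier G. translate G g y \<otimes>\<^bsub>A\<^esub> mu x (point_idem G g)) h u"
        using mu_galois[OF x y] by simp
      then have "(\<Sum>g\<in>carrier G. (translate G g y \<otimes>\<^bsub>A\<^esub> m x (point_idem G g)) h u)
          = (\<Sum>g\<in>carrier G. (translate G g y \<otimes>\<^bsub>A\<^esub> mu x (point_idem G g)) h u)"
        using x y fin by (simp add: A_finsum)
      then show "(\<Oplus>\<^bsub>A\<^esub>g\<in>carrier G. translate G g y \<otimes>\<^bsub>A\<^esub> z g) h u = \<zero>\<^bsub>A\<^esub> h u"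
        using y z fin by (simp add: A_finsum diff sum_subtractf A_zero)
    qed simp
  qed simp
  then have "z g h u = 0" if "h \<in> carrier G" "u \<in> S" for h u
    using that by (simp add: A_zero)
  then show ?thesis
    using x by (intro A_eqI) (auto simp: z_def A_add A_smult)
qed

text \<open>The e_g span k^G, so linearity extends the agreement, by induction on the support of p.
  Extensionality settles arguments outside the carriers.\<close>

lemma mu_unique:
  assumes m: "is_miyashita_ulbrich G A (translate G) m"
  shows "m = mu"
proof (rule extensionalityI[of _ "carrier A"])
  show "m \<in> extensional (carrier A)" "mu \<in> extensional (carrier A)"
    using m mu_is_miyashita_ulbrich by (auto simp: is_miyashita_ulbrich_def Let_def PiE_def)
  fix x assume x: "x \<in> carrier A"
  let ?H = "functions_on_group G :: ('k, 'a \<Rightarrow> 'k) module"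
  define eq where "eq p \<longleftrightarrow> m x p = mu x p" for p
  have add: "eq (p \<oplus>\<^bsub>?H\<^esub> q)" if "eq p" "eq q" "p \<in> extensional (carrier G)" "q \<in> extensional (carrier G)" for p q
    using m mu_is_miyashita_ulbrich x that
    by (auto simp: is_miyashita_ulbrich_def Let_def functions_on_group_simps eq_def)
  have smult: "m' x (k \<odot>\<^bsub>?H\<^esub> p) = k \<odot>\<^bsub>A\<^esub> m' x p"
    if "is_miyashita_ulbrich G A (translate G) m'" "p \<in> extensional (carrier G)" for m' k p
    using x that by (auto simp: is_miyashita_ulbrich_def Let_def functions_on_group_simps)
  show "m x = mu x"
  proof (rule extensionalityI[of _ "extensional (carrier G)"])
    show "m x \<in> extensional (extensional (carrier G))" "mu x \<in> extensional (extensional (carrier G))"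
      using m mu_is_miyashita_ulbrich x
      by (auto simp: is_miyashita_ulbrich_def Let_def PiE_def Pi_def functions_on_group_simps)
    fix p :: "'a \<Rightarrow> 'k" assume p: "p \<in> extensional (carrier G)"
    define res where "res I = (\<lambda>g\<in>carrier G. if g \<in> I then p g else 0)" for I
    have "eq (res I)" if "finite I" "I \<subseteq> carrier G" for I
      using that
    proof induction
      case empty
      have "res {} = 0 \<odot>\<^bsub>?H\<^esub> p"
        by (rule extensionalityI[of _ "carrier G"]) (auto simp: res_def functions_on_group_simps)
      moreover have "0 \<odot>\<^bsub>A\<^esub> a = 0 \<odot>\<^bsub>A\<^esub> b" for a b
        by (simp add: galois_algebra_def function_algebra_def twisted_group_algebra_def)
      ultimately show ?case
        using smult[OF m p, of 0] smult[OF mu_is_miyashita_ulbrich p, of 0] by (simp add: eq_def)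
    next
      case (insert a I)
      have "res (insert a I) = res I \<oplus>\<^bsub>?H\<^esub> p a \<odot>\<^bsub>?H\<^esub> point_idem G a"
        by (rule extensionalityI[of _ "carrier G"])
          (use insert in \<open>auto simp: res_def functions_on_group_simps point_idem_def\<close>)
      moreover have "eq (p a \<odot>\<^bsub>?H\<^esub> point_idem G a)"
        using smult[OF m] smult[OF mu_is_miyashita_ulbrich] mu_unique_point_idem[OF m x] insert
        by (simp add: eq_def)
      ultimately show ?case
        using insert by (auto intro!: add simp: functions_on_group_simps) (simp add: res_def)
    qed
    from this[OF fin] have "eq (res (carrier G))" by simp
    moreover have "res (carrier G) = p"
      by (rule extensionalityI[of _ "carrier G"]) (use p in \<open>auto simp: res_def\<close>)
    ultimately show "m x p = mu x p" by (simp add: eq_def)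
  qed
qed

lemma miyashita_ulbrich_eq_mu: "miyashita_ulbrich G A (translate G) = mu"
  unfolding miyashita_ulbrich_def using mu_is_miyashita_ulbrich mu_unique by (rule the_equality)

section \<open>Invariants of a normal subgroup\<close>

lemma invariants_iff:
  assumes "F \<subseteq> carrier G"
  shows "x \<in> invariants A (translate G) F \<longleftrightarrow>
    x \<in> carrier A \<and> (\<forall>g\<in>F. \<forall>h\<in>carrier G. \<forall>s\<in>S. x (h \<otimes> g) s = x h s)"
proof -
  have "translate G g x = x \<longleftrightarrow> (\<forall>h\<in>carrier G. \<forall>s\<in>S. x (h \<otimes> g) s = x h s)"
    if x: "x \<in> carrier A" and "g \<in> F" for g
  proof
    have "g \<in> carrier G" using assms \<open>g \<in> F\<close> by auto
    moreover assume "\<forall>h\<in>carrier G. \<forall>s\<in>S. x (h \<otimes> g) s = x h s"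
    ultimately show "translate G g x = x"
      using x by (intro A_eqI) (auto simp: translate_apply)
  qed (use translate_apply in metis)
  then show ?thesis by (auto simp: invariants_def)
qed

text \<open>Translation is linear, so the invariants always form an additive subgroup; only closure
  under the action of k^G is a condition.\<close>

lemma submodule_invariants_iff:
  assumes F: "F \<subseteq> carrier G"
  shows "submodule (invariants A (translate G) F) (functions_on_group G :: ('k, 'a \<Rightarrow> 'k) module)
      (miyashita_ulbrich_module G A (translate G)) \<longleftrightarrow>
    (\<forall>x\<in>invariants A (translate G) F. \<forall>p\<in>extensional (carrier G).
      mu x p \<in> invariants A (translate G) F)"
proof -
  interpret A: abelian_group A by (rule abelian_group_A)
  have minus: "\<ominus>\<^bsub>A\<^esub> x = (-1) \<odot>\<^bsub>A\<^esub> x" if "x \<in> carrier A" for x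
    using that by (intro A.minus_equality A_eqI) (auto simp: A_simps)
  have "subgroup (invariants A (translate G) F) (add_monoid A)"
  proof (rule group.subgroupI[OF A.a_group], unfold a_inv_def[symmetric])
    have "\<zero>\<^bsub>A\<^esub> \<in> invariants A (translate G) F"
      using F by (auto simp: invariants_iff[OF F] A_zero)
    then show "invariants A (translate G) F \<noteq> {}" by blast
  qed (use F in \<open>auto simp: invariants_iff[OF F] minus A_simps subset_iff\<close>)
  then have "subgroup (invariants A (translate G) F)
      (add_monoid (miyashita_ulbrich_module G A (translate G)))"
    by (simp add: subgroup_def m_inv_def miyashita_ulbrich_module_def)
  then show ?thesis
    unfolding submodule_def submodule_axioms_def
    by (simp add: miyashita_ulbrich_module_def miyashita_ulbrich_eq_mu functions_on_group_simps)
      blast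
qed

text \<open>Invariant functions are concentrated in degree 1, where p acts by the scalar
  p(1).\<close>

lemma mu_invariant_if_subset:
  assumes F: "F \<lhd> G" and "S \<subseteq> F"
    and x: "x \<in> invariants A (translate G) F" and p: "p \<in> extensional (carrier G)"
  shows "mu x p \<in> invariants A (translate G) F"
proof -
  interpret F: normal F G by (rule F)
  have inv: "x (h \<otimes> g) s = x h s" if "g \<in> F" "h \<in> carrier G" "s \<in> S" for g h s
    using x that by (auto simp: invariants_iff[OF F.subset])
  have xA: "x \<in> carrier A"
    using x by (simp add: invariants_def)
  have zero: "x h t = 0" if [simp]: "h \<in> carrier G" "t \<in> S" and "t \<noteq> \<one>" for h t
  proof -
    obtain r where [simp]: "r \<in> S" and r: "r \<otimes> t = t \<otimes> r" "c r t \<noteq> 1"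
      using nondegenerateE[OF \<open>t \<in> S\<close> \<open>t \<noteq> \<one>\<close>] .
    \<comment> \<open>Left multiplication of h by r is right multiplication by h^-1 r h, an element
      of the normal subgroup F. Hence x(h) is fixed under conjugation by x_r.\<close>
    have "conjg (inv h) r \<in> F"
      using F.inv_op_closed1[of h r] subsetD[OF \<open>S \<subseteq> F\<close> \<open>r \<in> S\<close>] by (simp add: conjg_def)
    then have "x (h \<otimes> conjg (inv h) r) t = x h t" by (simp add: inv)
    moreover have "h \<otimes> conjg (inv h) r = r \<otimes> h" by (simp add: conjg_def words)
    moreover have "x (r \<otimes> h) t = c r t * x h t"
      using A_carrier_equivariant[OF xA, of r h t] r by (simp add: conjg_fixed_iff[THEN iffD2])
    ultimately show ?thesis using r by simp
  qed
  have "mu x p (h \<otimes> g) s = mu x p h s" if "g \<in> F" "h \<in> carrier G" "s \<in> S" for g h s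
    using that xA p by (cases "s = \<one>") (auto simp: mu_apply inv zero)
  then show ?thesis
    using xA p by (simp add: invariants_iff[OF F.subset])
qed

text \<open>\<open>c t\<close> is a nontrivial character of the centralizer of t. The conditional
  keeps S as index set, so that the later double sum can be swapped.\<close>

lemma sum_c_centralizer_eq_0:
  assumes [simp]: "t \<in> S" and "t \<noteq> \<one>"
  shows "(\<Sum>s\<in>S. if t \<otimes> s = s \<otimes> t then c t s else 0) = 0"
    (is "sum ?f S = 0")
proof -
  obtain r where [simp]: "r \<in> S" and r: "r \<otimes> t = t \<otimes> r" "c t r \<noteq> 1"
    using nondegenerateE[OF assms] .
  have bij: "bij_betw (\<lambda>s. s \<otimes> r) S S"
    by (rule bij_betwI[where g = "\<lambda>s. s \<otimes> inv r"]) (auto simp: m_assoc)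
  have "?f (s \<otimes> r) = c t r * ?f s" if [simp]: "s \<in> S" for s
  proof -
    have "s \<otimes> r \<otimes> t = s \<otimes> t \<otimes> r" using r by (simp add: m_assoc)
    then have "t \<otimes> (s \<otimes> r) = s \<otimes> r \<otimes> t \<longleftrightarrow> t \<otimes> s = s \<otimes> t"
      by (simp flip: m_assoc)
    then show ?thesis
      using r by (simp add: c_mult_right_commuting)
  qed
  then have "sum ?f S = c t r * sum ?f S"
    by (subst sum.reindex_bij_betw[OF bij, symmetric]) (simp add: sum_distrib_left)
  then show ?thesis using r by simp
qed

end

text \<open>By Lagrange the index of F in K divides the prime index of F in G, so K has the order of
  F or of G.\<close>

lemma (in group) prime_index_maximal:
  assumes fin: "finite (carrier G)" and F: "subgroup F G" and prime: "prime (card (rcosets F))"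
    and K: "subgroup K G" and "F \<subseteq> K"
  shows "K = F \<or> K = carrier G"
proof -
  have "group (G\<lparr>carrier := K\<rparr>)"
    using K by (rule subgroup.subgroup_is_group) (rule group_axioms)
  moreover have "subgroup F (G\<lparr>carrier := K\<rparr>)"
    using F K \<open>F \<subseteq> K\<close> by (rule subgroup_incl)
  ultimately have "card (rcosets\<^bsub>G\<lparr>carrier := K\<rparr>\<^esub> F) * card F = card K"
    using group.lagrange[of "G\<lparr>carrier := K\<rparr>" F] by (simp add: Coset.order_def)
  then obtain n where n: "card K = n * card F" by metis
  have finF: "finite F" and finK: "finite K"
    using fin F K by (meson finite_subset subgroup.subset)+
  then have pos: "card F > 0"
    using subgroup.one_closed[OF F] by (auto simp: card_gt_0_iff)
  have "card (rcosets K) * card K = card (rcosets F) * card F"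
    using lagrange[OF F] lagrange[OF K] by simp
  then have "card (rcosets K) * n = card (rcosets F)"
    using pos by (simp add: n)
  then have "n dvd card (rcosets F)"
    by (metis dvd_triv_right)
  with prime have "n = 1 \<or> n = card (rcosets F)"
    by (auto simp: prime_nat_iff)
  then have "card K = card F \<or> card K = card (carrier G)"
    using n lagrange[OF F] by (auto simp: Coset.order_def)
  then show ?thesis
    using card_subset_eq[OF finK \<open>F \<subseteq> K\<close>] card_subset_eq[OF fin subgroup.subset[OF K]] by metis
qed

section \<open>The converse: consequences of stable invariants\<close>

locale invariant_subgroup = nondegenerate_cocycle_group G S \<alpha> + F: normal F G
  for G (structure) and S and \<alpha> :: "'a \<Rightarrow> 'a \<Rightarrow> 'k::field_char_0" and F +
  assumes stable: "\<And>x p. x \<in> invariants A (translate G) F \<Longrightarrow> p \<in> extensional (carrier G) \<Longrightarrow>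
      mu x p \<in> invariants A (translate G) F"
begin

text \<open>For \<open>T = S \<inter> F\<close>, a basis element \<open>x\<^sub>s\<close> contributes to the \<open>T\<close>-invariants of \<open>k\<^sub>\<alpha>S\<close>
  exactly if \<open>s\<close> is \<open>T\<close>-regular in the following sense.\<close>

definition regular :: "'a set" where
  "regular = {s \<in> S. \<forall>t\<in>S \<inter> F. t \<otimes> s = s \<otimes> t \<longrightarrow> c t s = 1}"

lemma finite_F [simp]: "finite F"
  using F.subset fin by (rule finite_subset)

text \<open>The \<open>F\<close>-average \<open>f\<close> of the function induced from \<open>x\<^sub>s\<close> is invariant with \<open>f(1)\<close> having a
  nonzero \<open>x\<^sub>s\<close>-coefficient; now apply stability to \<open>f\<close> and \<open>e\<^sub>s\<close>.\<close>

lemma regular_centralizes: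
  assumes s: "s \<in> regular" and g: "g \<in> F"
  shows "g \<otimes> s = s \<otimes> g"
proof -
  interpret A: abelian_group A by (rule abelian_group_A)
  have [simp]: "s \<in> S" "g \<in> carrier G" using s g by (auto simp: regular_def)
  define f where "f = (\<Oplus>\<^bsub>A\<^esub>g\<in>F. translate G g (induced \<one> s))"
  have f_closed [simp]: "f \<in> carrier A"
    by (auto simp: f_def intro!: A.finsum_closed)
  have f_apply: "f h v = (\<Sum>g\<in>F. induced \<one> s (h \<otimes> g) v)" if "h \<in> carrier G" "v \<in> S" for h v
    using that by (simp add: f_def A_finsum translate_apply)
  have f: "f \<in> invariants A (translate G) F"
    unfolding invariants_iff[OF F.subset]
  proof (intro conjI ballI)
    fix a h v assume [simp]: "a \<in> F" "h \<in> carrier G" "v \<in> S"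
    have bij: "bij_betw (\<lambda>g. a \<otimes> g) F F"
      by (rule bij_betwI[where g = "\<lambda>g. inv a \<otimes> g"]) auto
    have "f (h \<otimes> a) v = (\<Sum>g\<in>F. induced \<one> s (h \<otimes> (a \<otimes> g)) v)"
      by (simp add: f_apply m_assoc)
    also have "\<dots> = f h v"
      unfolding f_apply[OF \<open>h \<in> carrier G\<close> \<open>v \<in> S\<close>]
      by (rule sum.reindex_bij_betw[OF bij, where g = "\<lambda>g. induced \<one> s (h \<otimes> g) v"])
    finally show "f (h \<otimes> a) v = f h v" .
  qed simp
  \<comment> \<open>Only g in S commuting with s contribute, and regularity makes each contribution
    1: the coefficient counts the centralizer of s in S \<inter> F.\<close>
  have "f \<one> s = (\<Sum>g\<in>F. if g \<in> S \<and> conjg g s = s then 1 else 0)"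
    unfolding f_apply[OF one_closed \<open>s \<in> S\<close>]
    by (rule sum.cong) (use s in \<open>auto simp: induced_apply regular_def eq_commute[of s] conjg_fixed_iff\<close>)
  also have "\<dots> = of_nat (card {g \<in> F. g \<in> S \<and> conjg g s = s})"
    by (simp flip: sum.inter_filter)
  also have "\<dots> \<noteq> 0"
    using F.one_closed by (auto simp: card_eq_0_iff intro!: exI[of _ \<one>])
  finally have nz: "f \<one> s \<noteq> 0" .
  \<comment> \<open>The x_s-coefficient has degree s at 1 and degree g^-1 s g at g. It is the same
    nonzero number at both points, so a projection that keeps one and preserves invariance must keep
    the other.\<close>
  have "mu f (point_idem G s) \<in> invariants A (translate G) F"
    using f by (rule stable) simp
  then have "mu f (point_idem G s) (\<one> \<otimes> g) s = mu f (point_idem G s) \<one> s"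
    using g one_closed \<open>s \<in> S\<close> unfolding invariants_iff[OF F.subset] by blast
  moreover have "f (\<one> \<otimes> g) s = f \<one> s"
    using f g one_closed \<open>s \<in> S\<close> unfolding invariants_iff[OF F.subset] by blast
  ultimately have "(point_idem G s (conjg (inv g) s) :: 'k) = 1"
    using nz by (simp add: mu_apply point_idem_def)
  then have "conjg (inv g) s = s"
    by (simp add: point_idem_def split: if_splits)
  then have "conjg g s = s"
    by (metis S_carrier \<open>g \<in> carrier G\<close> \<open>s \<in> S\<close> conjg_inv(1))
  then show ?thesis by (simp add: conjg_fixed_iff)
qed

text \<open>For regular s, \<open>regular_centralizes\<close> makes every term 1; otherwise t
  \<mapsto> \<open>c t s\<close> is a nontrivial character of the centralizer of s in S \<inter>
  F.\<close>

lemma sum_c_regular: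
  assumes [simp]: "s \<in> S"
  shows "(\<Sum>t\<in>S \<inter> F. if t \<otimes> s = s \<otimes> t then c t s else 0)
    = (if s \<in> regular then of_nat (card (S \<inter> F)) else 0)"
    (is "sum ?f _ = _")
proof (cases "s \<in> regular")
  case True
  have "?f t = 1" if "t \<in> S \<inter> F" for t
  proof -
    have "t \<otimes> s = s \<otimes> t" using True that by (intro regular_centralizes) auto
    moreover from this have "c t s = 1" using True that unfolding regular_def by blast
    ultimately show ?thesis by simp
  qed
  then have "sum ?f (S \<inter> F) = (\<Sum>t\<in>S \<inter> F. 1)"
    by (intro sum.cong) auto
  with True show ?thesis by simp
next
  case False
  then obtain r where [simp]: "r \<in> S" "r \<in> F" and r: "r \<otimes> s = s \<otimes> r" "c r s \<noteq> 1"
    by (auto simp: regular_def)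
  have bij: "bij_betw (\<lambda>t. t \<otimes> r) (S \<inter> F) (S \<inter> F)"
    by (rule bij_betwI[where g = "\<lambda>t. t \<otimes> inv r"]) (auto simp: m_assoc)
  have "?f (t \<otimes> r) = c r s * ?f t" if [simp]: "t \<in> S" for t
  proof -
    have "conjg r s = s" using r by (simp add: conjg_fixed_iff)
    moreover have "t \<otimes> r \<otimes> s = t \<otimes> s \<otimes> r" using r by (simp add: m_assoc)
    then have "t \<otimes> r \<otimes> s = s \<otimes> (t \<otimes> r) \<longleftrightarrow> t \<otimes> s = s \<otimes> t"
      by (simp flip: m_assoc)
    ultimately show ?thesis
      by (simp add: c_mult_left)
  qed
  then have "sum ?f (S \<inter> F) = c r s * sum ?f (S \<inter> F)"
    by (subst sum.reindex_bij_betw[OF bij, symmetric]) (simp add: sum_distrib_left)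
  with r False show ?thesis by simp
qed

text \<open>The scalars \<open>c t s\<close> of commuting pairs are summed in both orders. Summed
  over s they give the trace of conjugation by x_t on k_\<alpha>S, which is zero unless t = 1.
  Characteristic zero brings the identity back to natural numbers.\<close>

lemma card_regular: "card regular * card (S \<inter> F) = card S"
proof -
  have "(of_nat (card regular * card (S \<inter> F)) :: 'k)
      = (\<Sum>s\<in>S. if s \<in> regular then of_nat (card (S \<inter> F)) else 0)"
    by (simp add: regular_def flip: sum.inter_filter)
  also have "\<dots> = (\<Sum>s\<in>S. \<Sum>t\<in>S \<inter> F. if t \<otimes> s = s \<otimes> t then c t s else 0)"
    by (simp add: sum_c_regular)
  also have "\<dots> = (\<Sum>t\<in>S \<inter> F. \<Sum>s\<in>S. if t \<otimes> s = s \<otimes> t then c t s else 0)"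
    by (rule sum.swap)
  also have "\<dots> = (\<Sum>t\<in>S \<inter> F. if t = \<one> then of_nat (card S) else 0)"
    by (rule sum.cong) (auto simp: sum_c_centralizer_eq_0)
  also have "\<dots> = of_nat (card S)"
    by simp
  finally show ?thesis
    by (simp only: of_nat_eq_iff)
qed

text \<open>Normality of F makes S \<inter> F stable under conjugation by S. With t r = r t',
  expanding \<open>c (t \<otimes> r) z\<close> in two ways transfers regularity from z to its
  conjugate.\<close>

lemma conjg_regular:
  assumes z: "z \<in> regular" and [simp]: "r \<in> S"
  shows "conjg r z \<in> regular"
proof -
  have [simp]: "z \<in> S" using z by (simp add: regular_def)
  have "c t (conjg r z) = 1" if t: "t \<in> S" "t \<in> F" "t \<otimes> conjg r z = conjg r z \<otimes> t" for t
  proof -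
    define t' where "t' = conjg (inv r) t"
    have t': "t' \<in> S" "t' \<in> F"
      using t F.inv_op_closed1[of r t] by (auto simp: t'_def conjg_def)
    have "t' \<otimes> z = conjg (inv r) (t \<otimes> conjg r z)" "z \<otimes> t' = conjg (inv r) (conjg r z \<otimes> t)"
      using t(1,2) by (simp_all add: t'_def conjg_mult_right)
    then have comm: "t' \<otimes> z = z \<otimes> t'" by (simp only: t(3))
    then have "c t' z = 1" using z t' by (auto simp: regular_def)
    moreover have "conjg t' z = z" using comm t' by (simp add: conjg_fixed_iff)
    moreover have "t \<otimes> r = r \<otimes> t'" using t by (simp add: t'_def conjg_def words)
    ultimately have "c t (conjg r z) * c r z = c r z"
      using c_mult_left[of t r z] c_mult_left[of r t' z] t t' by simp
    then show ?thesis by simp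
  qed
  then show ?thesis by (simp add: regular_def)
qed

text \<open>A nontrivial regular \<open>z\<close> has centralizer \<open>F\<close>, so its \<open>S\<close>-orbit has \<open>|S| / |S \<inter> F|\<close>
  elements, which is the number of all regular elements, including \<open>1\<close>.\<close>

lemma S_subset_F:
  assumes center: "grp_center G = {\<one>}"
    and maximal: "\<And>K. subgroup K G \<Longrightarrow> F \<subseteq> K \<Longrightarrow> K = F \<or> K = carrier G"
  shows "S \<subseteq> F"
proof (rule ccontr)
  assume "\<not> S \<subseteq> F"
  then have "S \<inter> F \<subset> S" by auto
  then have less: "card (S \<inter> F) < card S"
    by (simp add: psubset_card_mono)
  have fin_reg: "finite regular" by (simp add: regular_def)
  have one: "\<one> \<in> regular" by (simp add: regular_def)
  \<comment> \<open>Otherwise the count would make S \<inter> F as large as S.\<close>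
  have "regular \<noteq> {\<one>}"
    using card_regular less by auto
  with one obtain z where z: "z \<in> regular" "z \<noteq> \<one>" by blast
  then have [simp]: "z \<in> S" by (simp add: regular_def)
  define K where "K = {g \<in> carrier G. g \<otimes> z = z \<otimes> g}"
  have "subgroup K G"
  proof (rule subgroupI)
    fix a b assume a: "a \<in> K" and b: "b \<in> K"
    have [simp]: "a \<in> carrier G" "b \<in> carrier G" using a b by (auto simp: K_def)
    have fixed: "conjg a z = z" "conjg b z = z"
      using a b by (auto simp: K_def conjg_fixed_iff)
    have "conjg (a \<otimes> b) z = z" by (simp add: conjg_mult_left fixed)
    then show "a \<otimes> b \<in> K" by (simp add: K_def flip: conjg_fixed_iff)
    have "conjg (inv a) z = z" using conjg_inv(2)[of a z] by (simp add: fixed)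
    then show "inv a \<in> K" by (simp add: K_def flip: conjg_fixed_iff)
  qed (auto simp: K_def)
  moreover have "F \<subseteq> K"
    using regular_centralizes[OF z(1)] by (auto simp: K_def)
  moreover have "K \<noteq> carrier G"
  proof
    assume "K = carrier G"
    have "g \<otimes> z = z \<otimes> g" if "g \<in> carrier G" for g
    proof -
      from that have "g \<in> K" by (simp add: \<open>K = carrier G\<close>)
      then show ?thesis by (simp add: K_def)
    qed
    then have "z \<in> grp_center G" by (simp add: grp_center_def)
    with center z show False by simp
  qed
  ultimately have K: "K = F" using maximal by blast
  \<comment> \<open>A nonempty fibre of the orbit map is a coset of the centralizer of z in S, which
    is S \<inter> F because K = F.\<close>
  have fibre: "card {r \<in> S. conjg r z = y} \<le> card (S \<inter> F)" for y
  proof (cases "\<exists>r\<^sub>0\<in>S. conjg r\<^sub>0 z = y")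
    case True
    then obtain r\<^sub>0 where [simp]: "r\<^sub>0 \<in> S" and y: "y = conjg r\<^sub>0 z" by auto
    show ?thesis
    proof (rule card_inj_on_le[where f = "\<lambda>r. inv r\<^sub>0 \<otimes> r"])
      show "inj_on (\<lambda>r. inv r\<^sub>0 \<otimes> r) {r \<in> S. conjg r z = y}"
        by (auto simp: inj_on_def)
      have "inv r\<^sub>0 \<otimes> r \<in> K" if "r \<in> S" "conjg r z = y" for r
      proof -
        have "conjg (inv r\<^sub>0 \<otimes> r) z = z" using that by (simp add: conjg_mult_left y)
        then show ?thesis using that by (simp add: K_def flip: conjg_fixed_iff)
      qed
      then show "(\<lambda>r. inv r\<^sub>0 \<otimes> r) ` {r \<in> S. conjg r z = y} \<subseteq> S \<inter> F"
        by (auto simp: K)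
    qed simp
  next
    case False
    then have empty: "{r \<in> S. conjg r z = y} = {}" by auto
    show ?thesis unfolding empty by simp
  qed
  \<comment> \<open>No conjugate of z is 1, so the orbit misses a regular element; this breaks the
    count.\<close>
  have "conjg r z \<in> regular - {\<one>}" if "r \<in> S" for r
    using conjg_regular[OF z(1) that] conjg_cancel[of r z \<one>] that z(2) by simp
  then have "S = (\<Union>y\<in>regular - {\<one>}. {r \<in> S. conjg r z = y})" by auto
  then have "card S \<le> (\<Sum>y\<in>regular - {\<one>}. card {r \<in> S. conjg r z = y})"
    using card_UN_le[of "regular - {\<one>}" "\<lambda>y. {r \<in> S. conjg r z = y}"] fin_reg by simp
  also have "\<dots> \<le> (\<Sum>y\<in>regular - {\<one>}. card (S \<inter> F))"
    by (rule sum_mono) (rule fibre)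
  also have "\<dots> = (card regular - 1) * card (S \<inter> F)"
    using one by simp
  also have "\<dots> = card S - card (S \<inter> F)"
    by (simp add: diff_mult_distrib card_regular)
  \<comment> \<open>\<open>less\<close> excludes truncation in the subtraction of natural
    numbers.\<close>
  finally have "card (S \<inter> F) = 0"
    using less by linarith
  moreover have "\<one> \<in> S \<inter> F" by simp
  then have "S \<inter> F \<noteq> {}" by blast
  ultimately show False by (simp add: card_eq_0_iff)
qed

end

section \<open>Assembly of the two implications\<close>

theorem theorem6p2:
  fixes G :: "('g, 'm) monoid_scheme"
    and S F :: "'g set"
    and \<alpha> :: "'g \<Rightarrow> 'g \<Rightarrow> 'k :: {alg_closed_field, field_char_0}"
    and A :: "('k, 'g \<Rightarrow> 'g \<Rightarrow> 'k) module"
  assumes "group G" and "finite (carrier G)" and "grp_center G = {\<one>\<^bsub>G\<^esub>}"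
    and "subgroup S G"
    and "two_cocycle G S \<alpha>" and "nondegenerate_cocycle G S \<alpha>"
    and "A = galois_algebra G S \<alpha>"
    and "F \<lhd> G" and "prime (card (rcosets\<^bsub>G\<^esub> F))"
  shows "submodule (invariants A (translate G) F) (functions_on_group G :: ('k, 'g \<Rightarrow> 'k) module)
           (miyashita_ulbrich_module G A (translate G))
         \<longleftrightarrow> S \<subseteq> F"
proof -
  interpret nondegenerate_cocycle_group G S \<alpha>
    using assms
    by (simp add: nondegenerate_cocycle_group_def nondegenerate_cocycle_group_axioms_def
        cocycle_group_def cocycle_group_axioms_def)
  interpret F: normal F G by (rule assms(8))
  show ?thesis
    unfolding assms(7) submodule_invariants_iff[OF F.subset]
  proof
    assume stable: "\<forall>x\<in>invariants (galois_algebra G S \<alpha>) (translate G) F. \<forall>p\<in>extensional (carrier G).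
      mu x p \<in> invariants (galois_algebra G S \<alpha>) (translate G) F"
    interpret invariant_subgroup G S \<alpha> F
      by unfold_locales (use stable in blast)
    show "S \<subseteq> F"
      using assms(3) prime_index_maximal[OF assms(2) F.subgroup_axioms assms(9)] by (rule S_subset_F)
  qed (use mu_invariant_if_subset[OF assms(8)] in blast)
qed

end
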